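(* There exists a nonempty open set $\mathcal{U}^0\subset\Omega^0_B$ (respectively, a nonempty open set $\mathcal{U}^0\subset\Omega^0_\omega$), with respect to the $C^\infty$-topology, such that: (a) $\mathcal{U}^0$ is determined by the $3$-jet of the vector fields, i.e. whether a vector field of $\Omega^0_B$ (respectively $\Omega^0_\omega$) belongs to $\mathcal{U}^0$ depends only on its $3$-jet at the origin; (b) each $X\in\mathcal{U}^0$ possesses two $1$-parameter families of symmetric periodic solutions terminating at the equilibrium point $0$.
   Context: Fix coordinates $(x_1,y_1,x_2,y_2)$ on $\mathbb{R}^4$ and the standard symplectic form $\omega=dx_1\wedge dy_1+dx_2\wedge dy_2$. For a (germ at the origin of a) smooth function $H:(\mathbb{R}^4,0)\to\mathbb{R}$ the Hamiltonian vector field $X_H$ is given by $\dot x_i=\partial H/\partial y_i$, $\dot y_i=-\partial H/\partial x_i$, $i=1,2$. All Hamiltonians considered have the origin as an equilibrium point: $X_H(0)=0$. Let $R_0$ be the linear symplectic involution $R_0(x_1,y_1,x_2,y_2)=(x_1,y_1,-x_2,-y_2)$. A vector field $X$ is $R_0$-reversible if $X(R_0x)=-R_0X(x)$ for all $x$; for $X=X_H$ with $H(0)=0$ this is equivalent to $H\circ R_0=-H$. $\Omega^0$ denotes the space of $C^\infty$ $R_0$-reversible Hamiltonian vector fields on $(\mathbb{R}^4,0)$ having the origin as an equilibrium, endowed with the $C^\infty$-topology; its subsets carry the induced topology. The Poisson bracket is $\{f,g\}=\omega(X_f,X_g)$. A Hamiltonian vector field $X_H$ satisfies the Birkhoff Condition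 if $\{H_2,H\}=0$, where $H_2$ is the homogeneous part of degree $2$ of the Taylor expansion of $H$ at the origin. $\Omega^0_B\subset\Omega^0$ is the set of vector fields satisfying the Birkhoff Condition, and $\Omega^0_\omega\subset\Omega^0$ is the set of (real) analytic ones. A periodic orbit $\gamma$ is symmetric if $R_0(\gamma)=\gamma$. A $1$-parameter family of periodic solutions terminates at the equilibrium if the orbits of the family shrink to the equilibrium as the parameter tends to a limit value (here normalised to be $0$). *)

theory Defs
  imports "HOL-Analysis.Analysis"
begin

section \<open>Smooth germs, jets and the \<open>C\<^sup>\<infinity>\<close>-topology\<close>

text \<open>
  Germs at the origin are represented by total functions. Only the values on some neighbourhood
  of \<open>0\<close> matter: the spaces of vector fields and the existence of the families of orbits below do
  not change if a representative is modified away from \<open>0\<close>. The open sets of the topology on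
  germs are closed under equality near \<open>0\<close>, so that topology is the pullback of the one on
  equivalence classes.
\<close>

definition partial :: "'n::finite \<Rightarrow> (real^'n \<Rightarrow> 'b::real_normed_vector) \<Rightarrow> real^'n \<Rightarrow> 'b" where
  "partial i f = (\<lambda>x. frechet_derivative f (at x) (axis i 1))"

definition iter_partial ::
    "'n::finite list \<Rightarrow> (real^'n \<Rightarrow> 'b::real_normed_vector) \<Rightarrow> real^'n \<Rightarrow> 'b" where
  "iter_partial is f = foldr partial is f"

text \<open>Only used for open \<open>V\<close>; differentiability of all iterated partial derivatives makes all of
  them continuous, so this is being \<open>C\<^sup>\<infinity>\<close> on \<open>V\<close>.\<close>

definition smooth_on :: "(real^'n::finite) set \<Rightarrow> (real^'n \<Rightarrow> 'b::real_normed_vector) \<Rightarrow> bool" where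
  "smooth_on V f \<longleftrightarrow> (\<forall>is. \<forall>x\<in>V. iter_partial is f differentiable (at x))"

definition smooth_germ :: "(real^'n::finite \<Rightarrow> 'b::real_normed_vector) \<Rightarrow> bool" where
  "smooth_germ f \<longleftrightarrow> (\<exists>V. open V \<and> 0 \<in> V \<and> smooth_on V f)"

definition same_germ :: "(real^'n::finite \<Rightarrow> 'b) \<Rightarrow> (real^'n \<Rightarrow> 'b) \<Rightarrow> bool" where
  "same_germ f g \<longleftrightarrow> (\<forall>\<^sub>F x in nhds 0. f x = g x)"

definition same_jet ::
    "nat \<Rightarrow> (real^'n::finite \<Rightarrow> 'b::real_normed_vector) \<Rightarrow> (real^'n \<Rightarrow> 'b) \<Rightarrow> bool" where
  "same_jet k f g \<longleftrightarrow> (\<forall>is. length is \<le> k \<longrightarrow> iter_partial is f 0 = iter_partial is g 0)"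

text \<open>Membership in \<open>U \<subseteq> A\<close> depends, within \<open>A\<close>, only on the \<open>k\<close>-jet at the origin.\<close>

definition determined_by_jet ::
    "nat \<Rightarrow> (real^'n::finite \<Rightarrow> 'b::real_normed_vector) set \<Rightarrow> (real^'n \<Rightarrow> 'b) set \<Rightarrow> bool" where
  "determined_by_jet k A U \<longleftrightarrow> (\<forall>f\<in>A. \<forall>g\<in>A. same_jet k f g \<longrightarrow> (f \<in> U \<longleftrightarrow> g \<in> U))"

text \<open>Power series in several variables, indexed by multi-indices; unconditional convergence is
  absolute convergence for finite-dimensional \<open>'b\<close>.\<close>

definition analytic_germ :: "(real^'n::finite \<Rightarrow> 'b::real_normed_vector) \<Rightarrow> bool" where
  "analytic_germ f \<longleftrightarrow> (\<exists>r>0. \<exists>c :: nat^'n \<Rightarrow> 'b. \<forall>x. norm x < r \<longrightarrow>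
     ((\<lambda>a. (\<Prod>i\<in>UNIV. (x $ i) ^ (a $ i)) *\<^sub>R c a) has_sum f x) UNIV)"

definition Ck_close :: "(real^'n::finite) set \<Rightarrow> nat \<Rightarrow> real
    \<Rightarrow> (real^'n \<Rightarrow> 'b::real_normed_vector) \<Rightarrow> (real^'n \<Rightarrow> 'b) \<Rightarrow> bool" where
  "Ck_close K k e f g \<longleftrightarrow> (\<forall>is. length is \<le> k \<longrightarrow>
     (\<forall>x\<in>K. norm (iter_partial is g x - iter_partial is f x) < e))"

text \<open>
  The \<open>C\<^sup>\<infinity>\<close>-topology on germs is the final topology with respect to the maps from \<open>C\<^sup>\<infinity>(V)\<close> to
  germs, for \<open>V\<close> an open neighbourhood of \<open>0\<close>, where \<open>C\<^sup>\<infinity>(V)\<close> carries the topology of uniform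
  convergence of all derivatives on compact subsets of \<open>V\<close>.
\<close>

definition Cinf_open :: "(real^'n::finite \<Rightarrow> 'b::real_normed_vector) set \<Rightarrow> bool" where
  "Cinf_open U \<longleftrightarrow>
     U \<subseteq> Collect smooth_germ \<and>
     (\<forall>f\<in>U. \<forall>g. same_germ f g \<longrightarrow> g \<in> U) \<and>
     (\<forall>V. open V \<and> 0 \<in> V \<longrightarrow> (\<forall>f\<in>U. smooth_on V f \<longrightarrow>
        (\<exists>K k e. compact K \<and> K \<subseteq> V \<and> e > 0 \<and>
           (\<forall>g. smooth_on V g \<and> Ck_close K k e f g \<longrightarrow> g \<in> U))))"

definition Cinf_topology :: "(real^'n::finite \<Rightarrow> 'b::real_normed_vector) topology" where
  "Cinf_topology = topology Cinf_open"

lemma Ck_close_mono: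
  assumes "Ck_close K k e f g" "K' \<subseteq> K" "k' \<le> k" "e \<le> e'"
  shows "Ck_close K' k' e' f g"
  unfolding Ck_close_def
proof (intro allI impI ballI)
  fix "is" :: "'a list" and x
  assume "length is \<le> k'" "x \<in> K'"
  then have "norm (iter_partial is g x - iter_partial is f x) < e"
    using assms(1-3) unfolding Ck_close_def by auto
  then show "norm (iter_partial is g x - iter_partial is f x) < e'"
    using assms(4) by simp
qed

lemma Cinf_openD:
  assumes "Cinf_open U" "open V" "0 \<in> V" "f \<in> U" "smooth_on V f"
  obtains K k e where "compact K" "K \<subseteq> V" "e > 0"
    "\<And>g. smooth_on V g \<Longrightarrow> Ck_close K k e f g \<Longrightarrow> g \<in> U"
proof -
  have "\<exists>K k e. compact K \<and> K \<subseteq> V \<and> e > 0 \<and>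
      (\<forall>g. smooth_on V g \<and> Ck_close K k e f g \<longrightarrow> g \<in> U)"
    using assms(1)[unfolded Cinf_open_def, THEN conjunct2, THEN conjunct2, rule_format, of V f]
      assms(2-5) by simp
  then show ?thesis by (elim exE conjE) (rule that, auto)
qed

lemma Cinf_open_germ: "Cinf_open U \<Longrightarrow> f \<in> U \<Longrightarrow> same_germ f g \<Longrightarrow> g \<in> U"
  by (simp add: Cinf_open_def)

lemma Cinf_open_smooth: "Cinf_open U \<Longrightarrow> U \<subseteq> Collect smooth_germ"
  by (simp add: Cinf_open_def)

lemma Cinf_openI:
  assumes "U \<subseteq> Collect smooth_germ"
    and "\<And>f g. f \<in> U \<Longrightarrow> same_germ f g \<Longrightarrow> g \<in> U"
    and "\<And>V f. open V \<Longrightarrow> 0 \<in> V \<Longrightarrow> f \<in> U \<Longrightarrow> smooth_on V f \<Longrightarrow>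
      \<exists>K k e. compact K \<and> K \<subseteq> V \<and> e > 0 \<and>
           (\<forall>g. smooth_on V g \<and> Ck_close K k e f g \<longrightarrow> g \<in> U)"
  shows "Cinf_open U"
  unfolding Cinf_open_def
proof (intro conjI allI impI ballI)
  show "U \<subseteq> Collect smooth_germ" by (rule assms(1))
  show "g \<in> U" if "f \<in> U" "same_germ f g" for f g
    using that by (rule assms(2))
  show "\<exists>K k e. compact K \<and> K \<subseteq> V \<and> e > 0 \<and>
           (\<forall>g. smooth_on V g \<and> Ck_close K k e f g \<longrightarrow> g \<in> U)"
    if "open V \<and> 0 \<in> V" "f \<in> U" "smooth_on V f" for V f
    using assms(3)[OF conjunct1[OF that(1)] conjunct2[OF that(1)] that(2,3)] .
qed

lemma istopology_Cinf_open: "istopology Cinf_open"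
  unfolding istopology_def
proof (intro conjI allI impI)
  fix S T :: "(real^'n::finite \<Rightarrow> 'b::real_normed_vector) set"
  assume S: "Cinf_open S" and T: "Cinf_open T"
  show "Cinf_open (S \<inter> T)"
  proof (rule Cinf_openI)
    show "S \<inter> T \<subseteq> Collect smooth_germ"
      using Cinf_open_smooth[OF S] by (rule le_infI1)
    show "g \<in> S \<inter> T" if "f \<in> S \<inter> T" "same_germ f g" for f g
      using Cinf_open_germ[OF S _ that(2)] Cinf_open_germ[OF T _ that(2)] that(1) by simp
    fix V :: "(real^'n) set" and f :: "real^'n \<Rightarrow> 'b"
    assume V: "open V" "0 \<in> V" and f: "f \<in> S \<inter> T" and sm: "smooth_on V f"
    obtain K1 k1 e1 where 1: "compact K1" "K1 \<subseteq> V" "e1 > 0"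
        "\<And>g. smooth_on V g \<Longrightarrow> Ck_close K1 k1 e1 f g \<Longrightarrow> g \<in> S"
      using Cinf_openD[OF S V IntD1[OF f] sm] by metis
    obtain K2 k2 e2 where 2: "compact K2" "K2 \<subseteq> V" "e2 > 0"
        "\<And>g. smooth_on V g \<Longrightarrow> Ck_close K2 k2 e2 f g \<Longrightarrow> g \<in> T"
      using Cinf_openD[OF T V IntD2[OF f] sm] by metis
    have "g \<in> S \<inter> T" if "smooth_on V g" "Ck_close (K1 \<union> K2) (max k1 k2) (min e1 e2) f g" for g
    proof (rule IntI)
      show "g \<in> S" by (rule 1(4)[OF that(1) Ck_close_mono[OF that(2)]]) simp_all
      show "g \<in> T" by (rule 2(4)[OF that(1) Ck_close_mono[OF that(2)]]) simp_all
    qed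
    moreover have "compact (K1 \<union> K2)" "K1 \<union> K2 \<subseteq> V" "min e1 e2 > 0"
      using 1(1-3) 2(1-3) by (simp_all add: compact_Un)
    ultimately show "\<exists>K k e. compact K \<and> K \<subseteq> V \<and> e > 0 \<and>
           (\<forall>g. smooth_on V g \<and> Ck_close K k e f g \<longrightarrow> g \<in> S \<inter> T)"
      by (intro exI[of _ "K1 \<union> K2"] exI[of _ "max k1 k2"] exI[of _ "min e1 e2"]) simp
  qed
next
  fix \<K> :: "(real^'n::finite \<Rightarrow> 'b::real_normed_vector) set set"
  assume *: "\<forall>K\<in>\<K>. Cinf_open K"
  show "Cinf_open (\<Union>\<K>)"
  proof (rule Cinf_openI)
    show "\<Union>\<K> \<subseteq> Collect smooth_germ"
      by (rule Union_least) (rule Cinf_open_smooth[OF bspec[OF *]])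
    show "g \<in> \<Union>\<K>" if f: "f \<in> \<Union>\<K>" and fg: "same_germ f g" for f g
    proof -
      obtain S where S: "S \<in> \<K>" "f \<in> S" using f by auto
      show ?thesis by (rule UnionI[OF S(1) Cinf_open_germ[OF bspec[OF * S(1)] S(2) fg]])
    qed
    fix V :: "(real^'n) set" and f :: "real^'n \<Rightarrow> 'b"
    assume V: "open V" "0 \<in> V" and f: "f \<in> \<Union>\<K>" and sm: "smooth_on V f"
    obtain S where S: "S \<in> \<K>" "f \<in> S" using f by auto
    obtain K k e where K: "compact K" "K \<subseteq> V" "e > 0"
        "\<And>g. smooth_on V g \<Longrightarrow> Ck_close K k e f g \<Longrightarrow> g \<in> S"
      using Cinf_openD[OF bspec[OF * S(1)] V S(2) sm] by metis
    have "g \<in> \<Union>\<K>" if "smooth_on V g" "Ck_close K k e f g" for g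
      by (rule UnionI[OF S(1) K(4)[OF that]])
    with K(1-3) show "\<exists>K k e. compact K \<and> K \<subseteq> V \<and> e > 0 \<and>
           (\<forall>g. smooth_on V g \<and> Ck_close K k e f g \<longrightarrow> g \<in> \<Union>\<K>)"
      by (intro exI[of _ K] exI[of _ k] exI[of _ e]) simp
  qed
qed

lemma openin_Cinf_topology: "openin Cinf_topology U \<longleftrightarrow> Cinf_open U"
  by (simp add: Cinf_topology_def istopology_Cinf_open)

lemma iter_partial_cong_open:
  assumes V: "open V" and eq: "\<And>x. x \<in> V \<Longrightarrow> f x = g x" and x: "x \<in> V"
  shows "iter_partial is f x = iter_partial is g x"
  using x
proof (induction "is" arbitrary: x)
  case Nil
  then show ?case using eq by (simp add: iter_partial_def)
next
  case (Cons i js)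
  have "(iter_partial js f has_derivative D) (at x) \<longleftrightarrow> (iter_partial js g has_derivative D) (at x)"
    for D
  proof
    assume "(iter_partial js f has_derivative D) (at x)"
    then show "(iter_partial js g has_derivative D) (at x)"
      by (rule has_derivative_transform_within_open[OF _ V Cons.prems]) (rule Cons.IH)
  next
    assume "(iter_partial js g has_derivative D) (at x)"
    then show "(iter_partial js f has_derivative D) (at x)"
      by (rule has_derivative_transform_within_open[OF _ V Cons.prems]) (rule Cons.IH[symmetric])
  qed
  then have "frechet_derivative (iter_partial js f) (at x)
      = frechet_derivative (iter_partial js g) (at x)"
    by (simp add: frechet_derivative_def)
  then show ?case by (simp add: iter_partial_def partial_def)
qed

lemma smooth_germ_same_germ:
  assumes "smooth_germ f" "same_germ f g"
  shows "smooth_germ g"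
proof -
  obtain V where V: "open V" "0 \<in> V" "smooth_on V f"
    using assms(1) unfolding smooth_germ_def by blast
  obtain W where W: "open W" "0 \<in> W" "\<And>x. x \<in> W \<Longrightarrow> f x = g x"
    using assms(2) unfolding same_germ_def eventually_nhds by blast
  have "iter_partial is g differentiable (at x)" if x: "x \<in> V \<inter> W" for "is" x
  proof -
    obtain D where "(iter_partial is f has_derivative D) (at x)"
      using V(3) x unfolding smooth_on_def differentiable_def by blast
    then have "(iter_partial is g has_derivative D) (at x)"
      by (rule has_derivative_transform_within_open[OF _ W(1)])
        (use x iter_partial_cong_open[OF W(1) W(3)] in auto)
    then show ?thesis unfolding differentiable_def by blast
  qed
  then show ?thesis
    using V W unfolding smooth_germ_def smooth_on_def by (intro exI[of _ "V \<inter> W"]) auto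
qed

lemma topspace_Cinf_topology:
  "topspace (Cinf_topology :: (real^'n::finite \<Rightarrow> 'b::real_normed_vector) topology) = Collect smooth_germ"
proof -
  have "Cinf_open (Collect smooth_germ :: (real^'n \<Rightarrow> 'b) set)"
  proof (rule Cinf_openI)
    fix V :: "(real^'n) set" and f :: "real^'n \<Rightarrow> 'b"
    assume V: "open V" "0 \<in> V"
    have "smooth_germ g" if "smooth_on V g" for g :: "real^'n \<Rightarrow> 'b"
      unfolding smooth_germ_def using V that by (intro exI[of _ V]) simp
    then show "\<exists>K k e. compact K \<and> K \<subseteq> V \<and> (e::real) > 0 \<and>
        (\<forall>g. smooth_on V g \<and> Ck_close K k e f g \<longrightarrow> g \<in> Collect smooth_germ)"
      by (intro exI[of _ "{}"] exI[of _ 0] exI[of _ 1]) simp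
  qed (auto intro: smooth_germ_same_germ)
  then have "Collect smooth_germ \<subseteq> topspace (Cinf_topology :: (real^'n \<Rightarrow> 'b) topology)"
    by (intro openin_subset) (simp only: openin_Cinf_topology)
  moreover have "topspace (Cinf_topology :: (real^'n \<Rightarrow> 'b) topology) \<subseteq> Collect smooth_germ"
    using Cinf_open_smooth openin_topspace openin_Cinf_topology by metis
  ultimately show ?thesis by (rule subset_antisym[rotated])
qed


section \<open>Reversible Hamiltonian vector fields on \<open>(\<real>\<^sup>4, 0)\<close>\<close>

text \<open>The components \<open>1, 2, 3, 4\<close> of a vector are the coordinates \<open>x\<^sub>1, y\<^sub>1, x\<^sub>2, y\<^sub>2\<close>.\<close>

definition symplectic_form :: "real^4 \<Rightarrow> real^4 \<Rightarrow> real" where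
  "symplectic_form u v = (u$1 * v$2 - u$2 * v$1) + (u$3 * v$4 - u$4 * v$3)"

definition ham_vf :: "(real^4 \<Rightarrow> real) \<Rightarrow> real^4 \<Rightarrow> real^4" where
  "ham_vf H x = vector [partial 2 H x, - partial 1 H x, partial 4 H x, - partial 3 H x]"

definition poisson :: "(real^4 \<Rightarrow> real) \<Rightarrow> (real^4 \<Rightarrow> real) \<Rightarrow> real^4 \<Rightarrow> real" where
  "poisson f g x = symplectic_form (ham_vf f x) (ham_vf g x)"

definition quadratic_part :: "(real^4 \<Rightarrow> real) \<Rightarrow> real^4 \<Rightarrow> real" where
  "quadratic_part H x = (\<Sum>i\<in>UNIV. \<Sum>j\<in>UNIV. iter_partial [i, j] H 0 * x$i * x$j) / 2"

definition R0 :: "real^4 \<Rightarrow> real^4" where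
  "R0 x = vector [x$1, x$2, - x$3, - x$4]"

text \<open>\<open>H\<close> is determined by \<open>X\<close> as a germ, because of the normalisation \<open>H 0 = 0\<close>.\<close>

definition is_hamiltonian_of :: "(real^4 \<Rightarrow> real) \<Rightarrow> (real^4 \<Rightarrow> real^4) \<Rightarrow> bool" where
  "is_hamiltonian_of H X \<longleftrightarrow> smooth_germ H \<and> H 0 = 0 \<and> same_germ X (ham_vf H)"

definition reversible :: "(real^4 \<Rightarrow> real^4) \<Rightarrow> bool" where
  "reversible X \<longleftrightarrow> (\<forall>\<^sub>F x in nhds 0. X (R0 x) = - R0 (X x))"

definition Omega0 :: "(real^4 \<Rightarrow> real^4) set" where
  "Omega0 = {X. (\<exists>H. is_hamiltonian_of H X) \<and> X 0 = 0 \<and> reversible X}"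

definition Omega0_topology :: "(real^4 \<Rightarrow> real^4) topology" where
  "Omega0_topology = subtopology Cinf_topology Omega0"

definition birkhoff :: "(real^4 \<Rightarrow> real^4) \<Rightarrow> bool" where
  "birkhoff X \<longleftrightarrow> (\<exists>H. is_hamiltonian_of H X \<and> (\<forall>\<^sub>F x in nhds 0. poisson (quadratic_part H) H x = 0))"

definition Omega0_B :: "(real^4 \<Rightarrow> real^4) set" where
  "Omega0_B = {X \<in> Omega0. birkhoff X}"

definition Omega0_omega :: "(real^4 \<Rightarrow> real^4) set" where
  "Omega0_omega = {X \<in> Omega0. analytic_germ X}"


section \<open>Families of symmetric periodic solutions\<close>

definition periodic_solution ::
    "(real^4 \<Rightarrow> real^4) \<Rightarrow> real \<Rightarrow> (real \<Rightarrow> real^4) \<Rightarrow> bool" where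
  "periodic_solution X T \<gamma> \<longleftrightarrow>
     T > 0 \<and> (\<forall>t. (\<gamma> has_vector_derivative X (\<gamma> t)) (at t)) \<and>
     (\<forall>t. \<gamma> (t + T) = \<gamma> t) \<and> (\<exists>t. \<gamma> t \<noteq> \<gamma> 0)"

definition symmetric_orbit :: "(real \<Rightarrow> real^4) \<Rightarrow> bool" where
  "symmetric_orbit \<gamma> \<longleftrightarrow> R0 ` range \<gamma> = range \<gamma>"

text \<open>
  The parameter ranges over \<open>(0, \<delta>)\<close>, different parameters give different orbits, and the orbits
  shrink to the equilibrium as the parameter tends to \<open>0\<close>. Shrinking \<open>\<delta>\<close> puts all orbits
  into any given neighbourhood of \<open>0\<close>, so the values of the representative \<open>X\<close> away from
  \<open>0\<close> do not affect the existence of such families.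
\<close>

definition symmetric_periodic_family ::
    "(real^4 \<Rightarrow> real^4) \<Rightarrow> real \<Rightarrow> (real \<Rightarrow> real \<Rightarrow> real^4) \<Rightarrow> bool" where
  "symmetric_periodic_family X \<delta> \<gamma> \<longleftrightarrow>
     \<delta> > 0 \<and>
     (\<exists>T. continuous_on {0<..<\<delta>} T \<and> (\<forall>s\<in>{0<..<\<delta>}. periodic_solution X (T s) (\<gamma> s))) \<and>
     (\<forall>s\<in>{0<..<\<delta>}. symmetric_orbit (\<gamma> s)) \<and>
     continuous_on ({0<..<\<delta>} \<times> UNIV) (\<lambda>(s, t). \<gamma> s t) \<and>
     inj_on (\<lambda>s. range (\<gamma> s)) {0<..<\<delta>} \<and>
     (\<forall>e>0. \<forall>\<^sub>F s in at_right 0. \<forall>t. norm (\<gamma> s t) < e)"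

text \<open>The two families have no orbit in common.\<close>

definition has_two_symmetric_periodic_families :: "(real^4 \<Rightarrow> real^4) \<Rightarrow> bool" where
  "has_two_symmetric_periodic_families X \<longleftrightarrow>
     (\<exists>\<delta>\<^sub>1 \<gamma>\<^sub>1 \<delta>\<^sub>2 \<gamma>\<^sub>2.
        symmetric_periodic_family X \<delta>\<^sub>1 \<gamma>\<^sub>1 \<and> symmetric_periodic_family X \<delta>\<^sub>2 \<gamma>\<^sub>2 \<and>
        (\<forall>s\<in>{0<..<\<delta>\<^sub>1}. \<forall>s'\<in>{0<..<\<delta>\<^sub>2}. range (\<gamma>\<^sub>1 s) \<noteq> range (\<gamma>\<^sub>2 s')))"

end

theory Submission
  imports Defs
begin

text \<open>
  The idea is that near a semisimple centre every point of the symmetry plane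
  \<open>Fix R0 = {x\<^sub>2 = y\<^sub>2 = 0}\<close> lies on a symmetric periodic orbit, so that any two non-parallel rays
  in that plane give two families.

  Reversibility makes the linear part \<open>A\<close> of \<open>X\<close> exchange \<open>Fix R0\<close> with the plane
  \<open>{x\<^sub>1 = y\<^sub>1 = 0}\<close>, and being Hamiltonian ties the two off-diagonal blocks together: the
  block from \<open>Fix R0\<close> is minus the adjugate of the block \<open>B\<close> into \<open>Fix R0\<close>. Hence
  \<open>A\<^sup>2 = - det B\<close> (\<open>reversible_hamiltonian_square\<close>), and when \<open>det B > 0\<close> every linear orbit is
  periodic with frequency \<open>\<alpha> = sqrt (det B)\<close>. The open set is the set of fields with
  \<open>det B > 0\<close>, a condition on first derivatives at \<open>0\<close>.

  Start the nonlinear flow at \<open>s u\<close> with \<open>u\<close> a unit vector of \<open>Fix R0\<close>. As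
  \<open>s\<close> tends to \<open>0\<close>, the orbit divided by \<open>s\<close> converges, together with its velocity, to the linear
  one (\<open>flow_near_linear_flow\<close>), so its component along \<open>A u\<close> behaves like a positive multiple of
  \<open>sin (\<alpha> t)\<close> and has exactly one zero \<open>\<tau>\<close> near \<open>\<pi> / \<alpha>\<close> (\<open>first_return_to_zero\<close>).
  The return to \<open>Fix R0\<close> asks for two equations, but energy supplies the second: \<open>H\<close> vanishes on
  \<open>Fix R0\<close>, hence along the orbit, and near the orbit after half a turn the level set \<open>H = 0\<close> meets
  the hyperplane orthogonal to \<open>A u\<close> only in \<open>Fix R0\<close> (\<open>fixed_of_energy_zero\<close>). Thus the orbit is
  back in \<open>Fix R0\<close> at time \<open>\<tau>\<close> (\<open>half_return\<close>), and reversibility closes it up with period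
  \<open>2 \<tau>\<close> (\<open>flow_periodic\<close>). Between the two visits the component along \<open>A u\<close> is nonzero, so the orbit
  meets \<open>Fix R0\<close> just in \<open>s u\<close> and in a point near \<open>- s u\<close>; this separates the orbits of a family
  and the families along the \<open>x\<^sub>1\<close>- and the \<open>y\<^sub>1\<close>-axis from each other.

  The field is analysed after composition with the projection to a small ball, which makes it globally
  Lipschitz, keeps it reversible, and does not affect the small orbits.
\<close>

section \<open>Lipschitz differential equations\<close>

lemma has_vector_derivative_reflect:
  assumes "(f has_vector_derivative D) (at (- t) within uminus ` S)"
  shows "((\<lambda>t. f (- t)) has_vector_derivative - D) (at t within S)"
proof -
  have "(uminus has_vector_derivative (- 1)) (at t within S)"
    by (auto intro!: derivative_eq_intros)
  from vector_diff_chain_within[OF this assms] show ?thesis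
    by (simp add: o_def)
qed

text \<open>
  Gronwall's inequality with an inhomogeneity \<open>\<eta>\<close>, for the square of the norm because that is
  differentiable everywhere: from \<open>2 |v| \<eta> \<le> |v|\<^sup>2 + \<eta>\<^sup>2\<close> the function
  \<open>(|v|\<^sup>2 + \<eta>\<^sup>2) exp (- (2 L + 1) t)\<close> decreases. The case \<open>\<eta> = 0\<close> gives uniqueness and dependence on
  initial values, the case \<open>v 0 = 0\<close> gives comparison with the linearised equation.
\<close>

lemma gronwall_norm_square:
  fixes v :: "real \<Rightarrow> 'a::real_inner"
  assumes deriv: "\<And>t. 0 \<le> t \<Longrightarrow> t \<le> b \<Longrightarrow> (v has_vector_derivative v' t) (at t)"
    and bound: "\<And>t. 0 \<le> t \<Longrightarrow> t \<le> b \<Longrightarrow> norm (v' t) \<le> L * norm (v t) + \<eta>"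
    and "0 \<le> t" "t \<le> b" and L: "0 \<le> L"
  shows "(norm (v t))\<^sup>2 + \<eta>\<^sup>2 \<le> ((norm (v 0))\<^sup>2 + \<eta>\<^sup>2) * exp ((2 * L + 1) * t)"
proof -
  define g where "g = (\<lambda>t. (v t \<bullet> v t + \<eta>\<^sup>2) * exp (- (2 * L + 1) * t))"
  have "g t \<le> g 0"
  proof (rule DERIV_nonpos_imp_nonincreasing[OF assms(3)])
    fix r assume r: "0 \<le> r" "r \<le> t"
    then have rb: "r \<le> b" using assms(4) by simp
    have "((\<lambda>t. v t \<bullet> v t) has_vector_derivative v r \<bullet> v' r + v' r \<bullet> v r) (at r)"
      by (rule bounded_bilinear.has_vector_derivative[OF bounded_bilinear_inner deriv[OF r(1) rb] deriv[OF r(1) rb]])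
    then have sq: "((\<lambda>t. v t \<bullet> v t) has_real_derivative 2 * (v r \<bullet> v' r)) (at r)"
      by (simp add: has_real_derivative_iff_has_vector_derivative inner_commute)
    have "(g has_real_derivative
        (2 * (v r \<bullet> v' r) - (2 * L + 1) * (v r \<bullet> v r + \<eta>\<^sup>2)) * exp (- (2 * L + 1) * r)) (at r)"
      unfolding g_def by (rule derivative_eq_intros sq refl)+ (simp add: algebra_simps)
    moreover have "2 * (v r \<bullet> v' r) - (2 * L + 1) * (v r \<bullet> v r + \<eta>\<^sup>2) \<le> 0"
    proof -
      have Lnn: "0 \<le> L * \<eta>\<^sup>2" using L by simp
      have "v r \<bullet> v' r \<le> norm (v r) * norm (v' r)" by (rule norm_cauchy_schwarz)
      also have "\<dots> \<le> norm (v r) * (L * norm (v r) + \<eta>)"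
        using bound[OF r(1) rb] by (rule mult_left_mono) simp
      finally have 1: "2 * (v r \<bullet> v' r) \<le> 2 * L * (norm (v r))\<^sup>2 + 2 * norm (v r) * \<eta>"
        by (simp add: algebra_simps power2_eq_square)
      have "0 \<le> (norm (v r) - \<eta>)\<^sup>2" by simp
      then have "2 * norm (v r) * \<eta> \<le> (norm (v r))\<^sup>2 + \<eta>\<^sup>2" by (simp add: power2_diff)
      with 1 show ?thesis
        using Lnn by (simp add: algebra_simps power2_norm_eq_inner)
    qed
    ultimately show "\<exists>y. (g has_real_derivative y) (at r) \<and> y \<le> 0"
      using mult_nonpos_nonneg by (metis exp_ge_zero)
  qed
  then have "(v t \<bullet> v t + \<eta>\<^sup>2) * exp (- (2 * L + 1) * t) * exp ((2 * L + 1) * t)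
      \<le> (v 0 \<bullet> v 0 + \<eta>\<^sup>2) * exp ((2 * L + 1) * t)"
    unfolding g_def by (intro mult_right_mono) simp_all
  moreover have "exp (- (2 * L + 1) * t) * exp ((2 * L + 1) * t) = 1"
    by (simp flip: exp_add add: algebra_simps)
  ultimately show ?thesis
    by (simp only: mult.assoc power2_norm_eq_inner) simp
qed

lemma gronwall_norm_square_abs:
  fixes v :: "real \<Rightarrow> 'a::real_inner"
  assumes deriv: "\<And>t. (v has_vector_derivative v' t) (at t)"
    and bound: "\<And>t. norm (v' t) \<le> L * norm (v t)"
    and "0 \<le> L"
  shows "norm (v t) \<le> norm (v 0) * exp ((2 * L + 1) * \<bar>t\<bar>)"
proof -
  have sq: "(norm (v t))\<^sup>2 \<le> (norm (v 0))\<^sup>2 * exp ((2 * L + 1) * \<bar>t\<bar>)"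
  proof (cases "0 \<le> t")
    case True
    then show ?thesis
      using gronwall_norm_square[of t v v' L 0 t] assms by simp
  next
    case False
    have "((\<lambda>t. v (- t)) has_vector_derivative - v' (- s)) (at s)" for s
      using has_vector_derivative_reflect[of v "v' (- s)" s UNIV] deriv[of "- s"] by simp
    then show ?thesis
      using gronwall_norm_square[of "- t" "\<lambda>t. v (- t)" "\<lambda>t. - v' (- t)" L 0 "- t"] assms False
      by simp
  qed
  have "exp ((2 * L + 1) * \<bar>t\<bar>) \<le> (exp ((2 * L + 1) * \<bar>t\<bar>))\<^sup>2"
    using assms(3) by (simp add: power2_eq_square)
  then have "(norm (v t))\<^sup>2 \<le> (norm (v 0) * exp ((2 * L + 1) * \<bar>t\<bar>))\<^sup>2"
    using sq mult_left_mono[of "exp ((2 * L + 1) * \<bar>t\<bar>)" _ "(norm (v 0))\<^sup>2"]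
    by (smt (verit) power_mult_distrib zero_le_power2)
  then show ?thesis by (rule power2_le_imp_le) simp
qed

text \<open>
  In the norm \<open>sup exp (- 2 L t) |h t|\<close>, integration from \<open>0\<close> has operator norm at most \<open>1 / (2 L)\<close>;
  with this weight the Picard operator contracts on the whole half-line.
\<close>

lemma integral_exp_weight_bound:
  fixes h :: "real \<Rightarrow> 'a::banach"
  assumes "continuous_on UNIV h" "\<And>s. 0 \<le> s \<Longrightarrow> norm (h s) \<le> C * exp (2 * L * s)" "0 < L" "0 \<le> t" "0 \<le> C"
  shows "exp (- 2 * L * t) * norm (integral {0..t} h) \<le> C / (2 * L)"
proof -
  have "((\<lambda>s. C * exp (2 * L * s)) has_integral
      C * exp (2 * L * t) / (2 * L) - C * exp (2 * L * 0) / (2 * L)) {0..t}"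
  proof (rule fundamental_theorem_of_calculus[OF assms(4)])
    fix s
    have "((\<lambda>s. C * exp (2 * L * s) / (2 * L)) has_real_derivative C * exp (2 * L * s)) (at s within {0..t})"
      by (rule derivative_eq_intros refl)+ (use assms(3) in \<open>simp_all add: field_simps\<close>)
    then show "((\<lambda>s. C * exp (2 * L * s) / (2 * L)) has_vector_derivative C * exp (2 * L * s)) (at s within {0..t})"
      by (simp add: has_real_derivative_iff_has_vector_derivative)
  qed
  then have "norm (integral {0..t} h) \<le> C * exp (2 * L * t) / (2 * L) - C / (2 * L)"
    using integral_norm_bound_integral[of h "{0..t}" "\<lambda>s. C * exp (2 * L * s)"]
      integrable_continuous_interval[OF continuous_on_subset[OF assms(1)]] assms(2)
    by (auto simp: has_integral_iff)
  also have "\<dots> \<le> C * exp (2 * L * t) / (2 * L)" using assms(3,5) by simp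
  finally have "exp (- 2 * L * t) * norm (integral {0..t} h)
      \<le> exp (- 2 * L * t) * (C * exp (2 * L * t) / (2 * L))"
    by (rule mult_left_mono) simp
  also have "\<dots> = C / (2 * L)" by (simp add: mult_exp_exp algebra_simps)
  finally show ?thesis .
qed

lemma integral_from_zero_has_vector_derivative:
  fixes h :: "real \<Rightarrow> 'a::banach"
  assumes "continuous_on UNIV h" "0 \<le> t"
  shows "((\<lambda>u. integral {0..u} h) has_vector_derivative h t) (at t within {0..})"
proof -
  have "((\<lambda>u. integral {0..u} h) has_vector_derivative h t) (at t within {0..t + 1})"
    by (rule integral_has_vector_derivative) (use assms in \<open>auto intro: continuous_on_subset\<close>)
  moreover have "at t within {0..t + 1} = at t within {0..}"
    by (rule at_within_nhd[of _ "{..<t + 1}"]) auto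
  ultimately show ?thesis by simp
qed

text \<open>
  Picard iteration. The unknown \<open>g\<close> is the deviation from \<open>x0\<close> divided by \<open>exp (2 L t)\<close>, which
  is a bounded function, and the Picard operator halves distances between such functions.
\<close>

lemma lipschitz_ode_forward_solution:
  fixes F :: "'a::banach \<Rightarrow> 'a"
  assumes lip: "\<And>x y. norm (F x - F y) \<le> L * norm (x - y)" and L: "0 < L"
  obtains x where "x 0 = x0"
    "\<And>t. 0 \<le> t \<Longrightarrow> (x has_vector_derivative F (x t)) (at t within {0..})"
proof -
  have contF: "continuous_on A F" for A
    by (rule lipschitz_on_continuous_on[of L]) (auto simp: lipschitz_on_def dist_norm lip L less_imp_le)
  define h where "h g s = F (x0 + exp (2 * L * s) *\<^sub>R apply_bcontfun g s)" for g s
  have h_cont: "continuous_on UNIV (h g)" for g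
    unfolding h_def by (rule continuous_on_compose2[OF contF[of UNIV]]) (auto intro!: continuous_intros)
  \<comment> \<open>The absolute values extend the operator to negative times as an even function, so that it
      acts on bounded continuous functions on the whole line.\<close>
  define \<Phi> where "\<Phi> g t = exp (- 2 * L * \<bar>t\<bar>) *\<^sub>R integral {0..\<bar>t\<bar>} (h g)" for g t
  have \<Phi>_bcont: "\<Phi> g \<in> bcontfun" for g
  proof (rule bcontfun_normI)
    have "continuous_on {0..} (\<lambda>u. integral {0..u} (h g))"
      using integral_from_zero_has_vector_derivative[OF h_cont]
      by (auto simp: continuous_on_eq_continuous_within intro!: has_vector_derivative_continuous)
    then have "continuous_on UNIV (\<lambda>t. integral {0..\<bar>t\<bar>} (h g))"
      by (rule continuous_on_compose2[of "{0..}" _ UNIV abs]) (auto intro!: continuous_intros)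
    then show "continuous_on UNIV (\<Phi> g)"
      unfolding \<Phi>_def by (intro continuous_intros)
    fix t
    have "norm (h g s) \<le> (norm (F x0) + L * norm g) * exp (2 * L * s)" if "0 \<le> s" for s
    proof -
      have "norm (h g s) \<le> norm (F x0) + norm (h g s - F x0)" by norm
      also have "\<dots> \<le> norm (F x0) + L * (exp (2 * L * s) * norm (apply_bcontfun g s))"
        using lip[of "x0 + exp (2 * L * s) *\<^sub>R apply_bcontfun g s" x0] by (simp add: h_def)
      also have "\<dots> \<le> norm (F x0) * exp (2 * L * s) + L * (exp (2 * L * s) * norm g)"
        using that L by (intro add_mono mult_left_mono norm_bounded)
          (auto simp: mult_le_cancel_left1)
      finally show ?thesis by (simp add: algebra_simps)
    qed
    then have "exp (- 2 * L * \<bar>t\<bar>) * norm (integral {0..\<bar>t\<bar>} (h g)) \<le> (norm (F x0) + L * norm g) / (2 * L)"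
      by (intro integral_exp_weight_bound h_cont) (use L in auto)
    then show "norm (\<Phi> g t) \<le> (norm (F x0) + L * norm g) / (2 * L)"
      by (simp add: \<Phi>_def)
  qed
  have "\<exists>!g. Bcontfun (\<Phi> g) = g"
  proof (rule banach_fix_type[of "1/2"], simp, simp, intro allI)
    fix f g
    show "dist (Bcontfun (\<Phi> f)) (Bcontfun (\<Phi> g)) \<le> 1 / 2 * dist f g"
    proof (rule dist_bound)
      fix t
      have int: "h k integrable_on {0..\<bar>t\<bar>}" for k
        by (rule integrable_continuous_interval[OF continuous_on_subset[OF h_cont]]) simp
      have "norm (h f s - h g s) \<le> (L * dist f g) * exp (2 * L * s)" for s
      proof -
        have "norm (h f s - h g s) \<le> L * norm (exp (2 * L * s) *\<^sub>R (apply_bcontfun f s - apply_bcontfun g s))"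
          using lip[of "x0 + exp (2 * L * s) *\<^sub>R apply_bcontfun f s" "x0 + exp (2 * L * s) *\<^sub>R apply_bcontfun g s"]
          by (simp add: h_def algebra_simps)
        also have "\<dots> \<le> L * (exp (2 * L * s) * dist f g)"
          using dist_bounded[of f s g] L by (simp add: dist_norm)
        finally show ?thesis by (simp add: algebra_simps)
      qed
      then have "exp (- 2 * L * \<bar>t\<bar>) * norm (integral {0..\<bar>t\<bar>} (\<lambda>s. h f s - h g s)) \<le> (L * dist f g) / (2 * L)"
        by (intro integral_exp_weight_bound continuous_intros h_cont) (use L in auto)
      also have "integral {0..\<bar>t\<bar>} (\<lambda>s. h f s - h g s) = integral {0..\<bar>t\<bar>} (h f) - integral {0..\<bar>t\<bar>} (h g)"
        by (rule integral_diff[OF int int])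
      finally show "dist (apply_bcontfun (Bcontfun (\<Phi> f)) t) (apply_bcontfun (Bcontfun (\<Phi> g)) t) \<le> 1 / 2 * dist f g"
        using L by (simp add: Bcontfun_inverse \<Phi>_bcont dist_norm) (simp add: \<Phi>_def flip: scaleR_diff_right)
    qed
  qed
  then obtain g where "Bcontfun (\<Phi> g) = g" by blast
  then have g: "apply_bcontfun g t = \<Phi> g t" for t
    by (metis Bcontfun_inverse \<Phi>_bcont)
  define x where "x t = x0 + integral {0..t} (h g)" for t
  have "(x has_vector_derivative F (x t)) (at t within {0..})" if "0 \<le> t" for t
  proof -
    have "exp (2 * L * t) *\<^sub>R apply_bcontfun g t = integral {0..t} (h g)"
      using that by (simp add: g \<Phi>_def mult_exp_exp)
    then have "F (x t) = h g t" by (simp add: x_def h_def)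
    then show ?thesis
      using integral_from_zero_has_vector_derivative[OF h_cont that, of g]
      unfolding x_def by (auto intro!: derivative_eq_intros)
  qed
  moreover have "x 0 = x0" by (simp add: x_def)
  ultimately show ?thesis using that by blast
qed

lemma lipschitz_ode_solution:
  fixes F :: "'a::banach \<Rightarrow> 'a"
  assumes lip: "\<And>x y. norm (F x - F y) \<le> L * norm (x - y)" and L: "0 < L"
  shows "\<exists>x. x 0 = x0 \<and> (\<forall>t. (x has_vector_derivative F (x t)) (at t))"
proof -
  obtain a where a: "a 0 = x0" "\<And>t. 0 \<le> t \<Longrightarrow> (a has_vector_derivative F (a t)) (at t within {0..})"
    using lipschitz_ode_forward_solution[of F L, OF lip L] by blast
  have "norm (- F x - - F y) \<le> L * norm (x - y)" for x y
    using lip[of x y] by (simp add: norm_minus_commute)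
  from lipschitz_ode_forward_solution[of "\<lambda>x. - F x" L, OF this L]
  obtain b where b: "b 0 = x0" "\<And>t. 0 \<le> t \<Longrightarrow> (b has_vector_derivative - F (b t)) (at t within {0..})"
    by blast
  have b': "((\<lambda>t. b (- t)) has_vector_derivative F (b (- t))) (at t within {..0})" if "t \<le> 0" for t
    using has_vector_derivative_reflect[of b "- F (b (- t))" t "{..0}"] b(2)[of "- t"] that by simp
  define x where "x t = (if t \<in> {0..} then a t else b (- t))" for t
  have half_line: "{..<0} \<union> {0..} \<inter> {..0} = {..0::real}" by auto
  have "(x has_vector_derivative (if t \<in> {0..} then F (a t) else F (b (- t)))) (at t within UNIV)" for t
    unfolding x_def
    by (rule has_vector_derivative_If_within_closures[of _ "{0..}" "{..<0}"])
      (use a b b' in \<open>auto simp: half_line\<close>)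
  then have "(x has_vector_derivative F (x t)) (at t)" for t
    by (simp add: x_def if_distrib)
  moreover have "x 0 = x0" by (simp add: x_def a)
  ultimately show ?thesis by blast
qed

lemma ode_solutions_diverge_exponentially:
  fixes F :: "'a::real_inner \<Rightarrow> 'a"
  assumes lip: "\<And>x y. norm (F x - F y) \<le> L * norm (x - y)" and L: "0 \<le> L"
    and x: "\<And>t. (x has_vector_derivative F (x t)) (at t)"
    and y: "\<And>t. (y has_vector_derivative F (y t)) (at t)"
  shows "norm (x t - y t) \<le> norm (x 0 - y 0) * exp ((2 * L + 1) * \<bar>t\<bar>)"
  by (rule gronwall_norm_square_abs[where v' = "\<lambda>t. F (x t) - F (y t)"])
    (use assms in \<open>auto intro!: has_vector_derivative_diff\<close>)

section \<open>Partial derivatives and smooth germs\<close>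

lemma vector_4 [simp]:
  "(vector [a, b, c, d] :: 'a::zero ^ 4) $ 1 = a"
  "(vector [a, b, c, d] :: 'a ^ 4) $ 2 = b"
  "(vector [a, b, c, d] :: 'a ^ 4) $ 3 = c"
  "(vector [a, b, c, d] :: 'a ^ 4) $ 4 = d"
  unfolding vector_def by simp_all

lemma vec_eq_iff_4: "x = y \<longleftrightarrow> x $ 1 = y $ 1 \<and> x $ 2 = y $ 2 \<and> x $ 3 = y $ 3 \<and> x $ 4 = y $ 4"
  for x y :: "'a ^ 4"
  by (simp add: vec_eq_iff forall_4)

lemma inner_vec_4: "x \<bullet> y = x $ 1 * y $ 1 + x $ 2 * y $ 2 + x $ 3 * y $ 3 + x $ 4 * y $ 4"
  for x y :: "real ^ 4"
  by (simp add: inner_vec_def sum_4)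

lemma has_derivative_vec_componentwise:
  fixes f :: "'a::real_normed_vector \<Rightarrow> real ^ 'm::finite"
  shows "(f has_derivative D) (at x within S) \<longleftrightarrow>
    (\<forall>k. ((\<lambda>x. f x $ k) has_derivative (\<lambda>v. D v $ k)) (at x within S))"
  unfolding has_derivative_componentwise_within[of f] by (auto simp: Basis_vec_def inner_axis)

lemma partial_eq_derivative:
  assumes "(f has_derivative D) (at x)"
  shows "partial i f x = D (axis i 1)"
  unfolding partial_def by (simp flip: frechet_derivative_at[OF assms])

lemma has_derivative_sum_partial:
  fixes f :: "real ^ 'n::finite \<Rightarrow> 'b::real_normed_vector"
  assumes "f differentiable (at x)"
  shows "(f has_derivative (\<lambda>v. \<Sum>i\<in>UNIV. v $ i *\<^sub>R partial i f x)) (at x)"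
proof -
  have D: "(f has_derivative frechet_derivative f (at x)) (at x)"
    using assms by (simp add: frechet_derivative_works)
  then have "linear (frechet_derivative f (at x))" by (rule has_derivative_linear)
  then have "frechet_derivative f (at x) v = (\<Sum>i\<in>UNIV. v $ i *\<^sub>R partial i f x)" for v
    using linear_sum[of "frechet_derivative f (at x)" "\<lambda>i. v $ i *\<^sub>R axis i 1" UNIV] basis_expansion[of v]
    by (simp add: partial_def linear_cmul scalar_mult_eq_scaleR)
  then show ?thesis using D by presburger
qed

lemma smooth_onD: "smooth_on V f \<Longrightarrow> x \<in> V \<Longrightarrow> iter_partial is f differentiable (at x)"
  by (simp add: smooth_on_def)

lemma iter_partial_simps [simp]:
  "iter_partial [] f = f"
  "iter_partial (i # is) f = partial i (iter_partial is f)"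
  by (simp_all add: iter_partial_def)

lemma iter_partial_partial: "iter_partial is (partial i f) = iter_partial (is @ [i]) f"
  by (simp add: iter_partial_def)

lemma smooth_on_partial: "smooth_on V f \<Longrightarrow> smooth_on V (partial i f)"
  unfolding smooth_on_def iter_partial_partial by blast

lemma smooth_on_minus:
  fixes f :: "real ^ 'n::finite \<Rightarrow> 'b::real_normed_vector"
  assumes "open V" "smooth_on V f"
  shows "smooth_on V (\<lambda>x. - f x)"
proof -
  have "iter_partial is (\<lambda>x. - f x) differentiable (at x) \<and> iter_partial is (\<lambda>x. - f x) x = - iter_partial is f x"
    if "x \<in> V" for "is" x
    using that
  proof (induction "is" arbitrary: x)
    case Nil
    then show ?case using smooth_onD[OF assms(2), of x "[]"] by simp
  next
    case (Cons i js)
    have eq: "partial i (iter_partial js (\<lambda>x. - f x)) y = - partial i (iter_partial js f) y" if "y \<in> V" for y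
    proof -
      obtain D where D: "(iter_partial js f has_derivative D) (at y)"
        using smooth_onD[OF assms(2) \<open>y \<in> V\<close>] unfolding differentiable_def by blast
      have "(iter_partial js (\<lambda>x. - f x) has_derivative (\<lambda>v. - D v)) (at y)"
        by (rule has_derivative_transform_within_open[OF has_derivative_minus[OF D] assms(1) that])
          (simp add: Cons.IH)
      then show ?thesis by (simp add: partial_eq_derivative partial_eq_derivative[OF D])
    qed
    obtain D where D: "(partial i (iter_partial js f) has_derivative D) (at x)"
      using smooth_onD[OF assms(2) Cons.prems, of "i # js"] unfolding differentiable_def by auto
    have "(partial i (iter_partial js (\<lambda>x. - f x)) has_derivative (\<lambda>v. - D v)) (at x)"
      by (rule has_derivative_transform_within_open[OF has_derivative_minus[OF D] assms(1) Cons.prems])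
        (simp add: eq)
    then show ?case using eq[OF Cons.prems] by (auto simp: differentiable_def)
  qed
  then show ?thesis by (simp add: smooth_on_def)
qed

lemma smooth_on_componentwise:
  fixes f :: "real ^ 'n::finite \<Rightarrow> real ^ 'm::finite"
  assumes "open V" "\<And>k. smooth_on V (\<lambda>x. f x $ k)"
  shows "smooth_on V f"
proof -
  have diff: "g differentiable (at x)" if "x \<in> V" "\<And>y. y \<in> V \<Longrightarrow> g y = (\<chi> k. iter_partial is (\<lambda>x. f x $ k) y)"
    for g "is" x
  proof -
    have "\<forall>k. \<exists>D. (iter_partial is (\<lambda>x. f x $ k) has_derivative D) (at x)"
      using smooth_onD[OF assms(2) that(1)] unfolding differentiable_def by blast
    then obtain D where D: "\<And>k. (iter_partial is (\<lambda>x. f x $ k) has_derivative D k) (at x)" by metis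
    have "((\<lambda>x. \<chi> k. iter_partial is (\<lambda>x. f x $ k) x) has_derivative (\<lambda>v. \<chi> k. D k v)) (at x)"
      by (subst has_derivative_vec_componentwise) (simp add: D)
    then have "(g has_derivative (\<lambda>v. \<chi> k. D k v)) (at x)"
      by (rule has_derivative_transform_within_open[OF _ assms(1) that(1)]) (simp add: that(2))
    then show ?thesis by (auto simp: differentiable_def)
  qed
  have "iter_partial is f x = (\<chi> k. iter_partial is (\<lambda>x. f x $ k) x)" if "x \<in> V" for "is" x
    using that
  proof (induction "is" arbitrary: x)
    case Nil
    then show ?case by (simp add: vec_eq_iff)
  next
    case (Cons i js)
    obtain D where D: "(iter_partial js f has_derivative D) (at x)"
      using diff[OF Cons.prems Cons.IH] by (auto simp: differentiable_def)
    have comp: "(iter_partial js (\<lambda>x. f x $ k) has_derivative (\<lambda>v. D v $ k)) (at x)" for k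
      by (rule has_derivative_transform_within_open[OF D[unfolded has_derivative_vec_componentwise, rule_format] assms(1) Cons.prems])
        (simp add: Cons.IH)
    then show ?case
      by (simp add: vec_eq_iff partial_eq_derivative[OF D] partial_eq_derivative[OF comp])
  qed
  then show ?thesis
    unfolding smooth_on_def using diff by blast
qed

text \<open>
  Elements of \<open>Omega0\<close> are given through their Hamiltonians; that they are smooth themselves is what
  makes them points of the space on which the topology lives.
\<close>

lemma smooth_on_ham_vf:
  assumes "open V" "smooth_on V H"
  shows "smooth_on V (ham_vf H)"
proof (rule smooth_on_componentwise[OF assms(1)])
  note sm = smooth_on_partial[OF assms(2)]
  have "\<forall>k. smooth_on V (\<lambda>x. ham_vf H x $ k)"
    unfolding forall_4 by (auto simp: ham_vf_def intro: sm smooth_on_minus[OF assms(1)])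
  then show "smooth_on V (\<lambda>x. ham_vf H x $ k)" for k ..
qed

lemma smooth_germ_Omega0: "X \<in> Omega0 \<Longrightarrow> smooth_germ X"
proof -
  assume "X \<in> Omega0"
  then obtain H where H: "smooth_germ H" "same_germ X (ham_vf H)"
    unfolding Omega0_def is_hamiltonian_of_def by blast
  from H(1) have "smooth_germ (ham_vf H)"
    unfolding smooth_germ_def using smooth_on_ham_vf by blast
  moreover from H(2) have "same_germ (ham_vf H) X"
    unfolding same_germ_def by (rule eventually_mono) simp
  ultimately show ?thesis by (rule smooth_germ_same_germ)
qed

lemma smooth_on_locally_lipschitz:
  fixes f :: "real ^ 'n::finite \<Rightarrow> 'b::real_normed_vector"
  assumes "open V" "a \<in> V" "smooth_on V f"
  shows "\<exists>r>0. \<exists>L>0. \<forall>x\<in>cball a r. \<forall>y\<in>cball a r. norm (f x - f y) \<le> L * norm (x - y)"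
proof -
  have "\<forall>\<^sub>F x in nhds a. norm (partial i f x) < norm (partial i f a) + 1" for i
  proof -
    have "partial i f differentiable (at a)"
      using smooth_onD[OF assms(3,2), of "[i]"] by simp
    then have "isCont (partial i f) a" by (rule differentiable_imp_continuous_within)
    then have "((\<lambda>x. norm (partial i f x)) \<longlongrightarrow> norm (partial i f a)) (nhds a)"
      by (intro tendsto_norm) (simp add: isCont_def tendsto_at_iff_tendsto_nhds)
    then show ?thesis by (rule order_tendstoD) simp
  qed
  then have "\<forall>\<^sub>F x in nhds a. x \<in> V \<and> (\<forall>i. norm (partial i f x) < norm (partial i f a) + 1)"
    using eventually_nhds_in_open[OF assms(1,2)] by (auto simp: eventually_conj_iff intro: eventually_all_finite)
  then obtain r where r: "r > 0" "\<And>x. dist x a < r \<Longrightarrow> x \<in> V"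
      "\<And>x i. dist x a < r \<Longrightarrow> norm (partial i f x) < norm (partial i f a) + 1"
    unfolding eventually_nhds_metric by blast
  define L where "L = (\<Sum>i\<in>UNIV. norm (partial i f a) + 1)"
  have "L > 0" unfolding L_def by (intro sum_pos) (auto simp: add_nonneg_pos)
  moreover have "norm (f x - f y) \<le> L * norm (x - y)" if "x \<in> cball a (r / 2)" "y \<in> cball a (r / 2)" for x y
  proof (rule differentiable_bound[OF convex_cball _ _ that])
    fix z assume "z \<in> cball a (r / 2)"
    then have z: "dist z a < r" using r(1) by (simp add: dist_commute)
    have "f differentiable (at z)"
      using smooth_onD[OF assms(3) r(2)[OF z], of "[]"] by simp
    then show "(f has_derivative (\<lambda>v. \<Sum>i\<in>UNIV. v $ i *\<^sub>R partial i f z)) (at z within cball a (r / 2))"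
      by (rule has_derivative_at_withinI[OF has_derivative_sum_partial])
    show "onorm (\<lambda>v. \<Sum>i\<in>UNIV. v $ i *\<^sub>R partial i f z) \<le> L"
    proof (rule onorm_le)
      fix v :: "real ^ 'n"
      have "norm (\<Sum>i\<in>UNIV. v $ i *\<^sub>R partial i f z) \<le> (\<Sum>i\<in>UNIV. \<bar>v $ i\<bar> * norm (partial i f z))"
        by (rule order_trans[OF norm_sum]) simp
      also have "\<dots> \<le> (\<Sum>i\<in>UNIV. norm v * (norm (partial i f a) + 1))"
        by (intro sum_mono mult_mono component_le_norm_cart) (auto intro: less_imp_le r(3)[OF z])
      finally show "norm (\<Sum>i\<in>UNIV. v $ i *\<^sub>R partial i f z) \<le> L * norm v"
        by (simp add: L_def sum_distrib_left mult.commute)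
    qed
  qed
  ultimately show ?thesis using r(1) by (intro exI[of _ "r / 2"]) auto
qed

text \<open>
  Schwarz's theorem at a single point, assuming only that the differential \<open>G\<close> of \<open>H\<close> is
  differentiable there: the second difference of \<open>H\<close> over the parallelogram spanned by \<open>h a\<close> and
  \<open>h b\<close>, divided by \<open>h\<^sup>2\<close>, tends to \<open>Q a b\<close>, and it is symmetric in \<open>a\<close> and \<open>b\<close>. For a Hamiltonian
  field this is the statement that its linear part is a Hamiltonian matrix.
\<close>

lemma second_derivative_symmetric:
  fixes H :: "'a::real_normed_vector \<Rightarrow> real"
  assumes "r > 0" and H: "\<And>x. x \<in> ball 0 r \<Longrightarrow> (H has_derivative G x) (at x)"
    and G: "\<And>v. ((\<lambda>x. G x v) has_derivative (\<lambda>h. Q h v)) (at 0)"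
  shows "Q a b = Q b a"
proof -
  have approx: "\<exists>d>0. \<forall>h. 0 < h \<and> h < d \<longrightarrow>
      \<bar>(H (h *\<^sub>R a + h *\<^sub>R b) - H (h *\<^sub>R a) - H (h *\<^sub>R b) + H 0) / h\<^sup>2 - Q a b\<bar> \<le> e"
    if "e > 0" for e a b
  proof -
    define N where "N = norm a + norm b + 1"
    have N: "N > 0" by (simp add: N_def add_nonneg_pos)
    have lin: "linear (\<lambda>h. Q h b)" using has_derivative_linear[OF G] .
    obtain d where d: "d > 0" "\<And>y. norm y < d \<Longrightarrow> \<bar>G y b - G 0 b - Q y b\<bar> \<le> e / (2 * N) * norm y"
    proof -
      have "e / (2 * N) > 0" using \<open>e > 0\<close> N by simp
      from G[of b, unfolded has_derivative_at_alt, THEN conjunct2, rule_format, OF this]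
      show ?thesis using that by auto
    qed
    have "\<bar>(H (h *\<^sub>R a + h *\<^sub>R b) - H (h *\<^sub>R a) - H (h *\<^sub>R b) + H 0) / h\<^sup>2 - Q a b\<bar> \<le> e"
      if h: "0 < h" "h < min d r / N" for h
    proof -
      have hN: "h * N < d" "h * N < r" using h(2) N by (simp_all add: field_simps)
      have small: "norm (h *\<^sub>R a + t *\<^sub>R h *\<^sub>R b) \<le> h * N" "norm (t *\<^sub>R h *\<^sub>R b) \<le> h * N"
        if t: "0 \<le> t" "t \<le> 1" for t
      proof -
        have tb: "norm (t *\<^sub>R h *\<^sub>R b) \<le> h * norm b"
          using t h(1) by (simp add: mult_left_le_one_le)
        show "norm (t *\<^sub>R h *\<^sub>R b) \<le> h * N"
          by (rule order_trans[OF tb]) (use h(1) in \<open>simp add: N_def\<close>)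
        have "norm (h *\<^sub>R a + t *\<^sub>R h *\<^sub>R b) \<le> h * norm a + h * norm b"
          by (rule order_trans[OF norm_triangle_ineq add_mono[OF _ tb]]) (use h(1) in simp)
        also have "\<dots> \<le> h * N" using h(1) by (simp add: N_def algebra_simps)
        finally show "norm (h *\<^sub>R a + t *\<^sub>R h *\<^sub>R b) \<le> h * N" .
      qed
      define g where "g t = H (h *\<^sub>R a + t *\<^sub>R h *\<^sub>R b) - H (t *\<^sub>R h *\<^sub>R b)" for t
      have "(g has_real_derivative G (h *\<^sub>R a + t *\<^sub>R h *\<^sub>R b) (h *\<^sub>R b) - G (t *\<^sub>R h *\<^sub>R b) (h *\<^sub>R b)) (at t)"
        if t: "0 \<le> t" "t \<le> 1" for t
      proof -
        have in_ball: "h *\<^sub>R a + t *\<^sub>R h *\<^sub>R b \<in> ball 0 r" "t *\<^sub>R h *\<^sub>R b \<in> ball 0 r"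
          using small[OF t] hN by auto
        have "((\<lambda>t. h *\<^sub>R a + t *\<^sub>R h *\<^sub>R b) has_derivative (\<lambda>s. s *\<^sub>R h *\<^sub>R b)) (at t)"
          "((\<lambda>t. t *\<^sub>R h *\<^sub>R b) has_derivative (\<lambda>s. s *\<^sub>R h *\<^sub>R b)) (at t)"
          by (auto intro!: derivative_eq_intros)
        from has_derivative_compose[OF this(1) H[OF in_ball(1)]] has_derivative_compose[OF this(2) H[OF in_ball(2)]]
        have "(g has_derivative (\<lambda>s. G (h *\<^sub>R a + t *\<^sub>R h *\<^sub>R b) (s *\<^sub>R h *\<^sub>R b) - G (t *\<^sub>R h *\<^sub>R b) (s *\<^sub>R h *\<^sub>R b))) (at t)"
          unfolding g_def by (rule has_derivative_diff)
        moreover have "G x (s *\<^sub>R v) = s * G x v" if "x \<in> ball 0 r" for x s v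
          using linear_cmul[OF has_derivative_linear[OF H[OF that]]] by simp
        ultimately have "(g has_derivative (\<lambda>s. s * G (h *\<^sub>R a + t *\<^sub>R h *\<^sub>R b) (h *\<^sub>R b) - s * G (t *\<^sub>R h *\<^sub>R b) (h *\<^sub>R b))) (at t)"
          using in_ball by (simp only:)
        then show ?thesis
          unfolding has_field_derivative_def by (rule has_derivative_eq_rhs) (simp add: fun_eq_iff algebra_simps)
      qed
      \<comment> \<open>The second difference is the increment over \<open>[0, 1]\<close> of \<open>g\<close>, which slides the segment
          \<open>h a\<close> in the direction \<open>h b\<close>.\<close>
      from MVT2[OF zero_less_one this] obtain t where t: "0 < t" "t < 1"
        and "g 1 - g 0 = G (h *\<^sub>R a + t *\<^sub>R h *\<^sub>R b) (h *\<^sub>R b) - G (t *\<^sub>R h *\<^sub>R b) (h *\<^sub>R b)"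
        by auto
      moreover have t': "0 \<le> t" "t \<le> 1" using t by auto
      have "G x (h *\<^sub>R b) = h * G x b" if "norm x \<le> h * N" for x
        using linear_cmul[OF has_derivative_linear[OF H[of x]]] that hN by simp
      ultimately have g_diff: "g 1 - g 0 = h * (G (h *\<^sub>R a + t *\<^sub>R h *\<^sub>R b) b - G (t *\<^sub>R h *\<^sub>R b) b)"
        using small[OF t'] by (simp add: algebra_simps)
      have "\<bar>G y b - G 0 b - Q y b\<bar> \<le> e / 2 * h" if "norm y \<le> h * N" for y
      proof -
        have "\<bar>G y b - G 0 b - Q y b\<bar> \<le> e / (2 * N) * (h * N)"
          by (rule order_trans[OF d(2) mult_left_mono[OF that]]) (use that hN(1) \<open>e > 0\<close> N in auto)
        also have "\<dots> = e / 2 * h" using N by simp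
        finally show ?thesis .
      qed
      from this[OF small(1)[OF t']] this[OF small(2)[OF t']]
      have "\<bar>(G (h *\<^sub>R a + t *\<^sub>R h *\<^sub>R b) b - G (t *\<^sub>R h *\<^sub>R b) b) -
          (Q (h *\<^sub>R a + t *\<^sub>R h *\<^sub>R b) b - Q (t *\<^sub>R h *\<^sub>R b) b)\<bar> \<le> e * h" by linarith
      moreover have "Q (h *\<^sub>R a + t *\<^sub>R h *\<^sub>R b) b - Q (t *\<^sub>R h *\<^sub>R b) b = h * Q a b"
        using linear_add[OF lin] linear_cmul[OF lin] by simp
      ultimately have "\<bar>(g 1 - g 0) / h - h * Q a b\<bar> \<le> e * h"
        using h(1) g_diff by simp
      moreover have "(g 1 - g 0) / h\<^sup>2 - Q a b = ((g 1 - g 0) / h - h * Q a b) / h"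
        using h(1) by (simp add: field_simps power2_eq_square)
      ultimately have "\<bar>(g 1 - g 0) / h\<^sup>2 - Q a b\<bar> \<le> e"
        using h(1) by (simp add: abs_divide pos_divide_le_eq)
      then show ?thesis by (simp add: g_def algebra_simps)
    qed
    then show ?thesis using d(1) assms(1) N by (intro exI[of _ "min d r / N"]) auto
  qed
  have "\<bar>Q a b - Q b a\<bar> \<le> 0 + e" if "e > 0" for e
  proof -
    have "e / 2 > 0" using that by simp
    from approx[OF this, of a b] approx[OF this, of b a] obtain d1 d2 where d: "d1 > 0" "d2 > 0"
      and 1: "\<And>h. 0 < h \<and> h < d1 \<Longrightarrow>
      \<bar>(H (h *\<^sub>R a + h *\<^sub>R b) - H (h *\<^sub>R a) - H (h *\<^sub>R b) + H 0) / h\<^sup>2 - Q a b\<bar> \<le> e / 2"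
      and 2: "\<And>h. 0 < h \<and> h < d2 \<Longrightarrow>
      \<bar>(H (h *\<^sub>R b + h *\<^sub>R a) - H (h *\<^sub>R b) - H (h *\<^sub>R a) + H 0) / h\<^sup>2 - Q b a\<bar> \<le> e / 2"
      by blast
    define h where "h = min d1 d2 / 2"
    define \<Delta> where "\<Delta> = (H (h *\<^sub>R a + h *\<^sub>R b) - H (h *\<^sub>R a) - H (h *\<^sub>R b) + H 0) / h\<^sup>2"
    have "0 < h" "h < d1" "h < d2" using d by (auto simp: h_def)
    then have "\<bar>\<Delta> - Q a b\<bar> \<le> e / 2" "\<bar>\<Delta> - Q b a\<bar> \<le> e / 2"
      using 1[of h] 2[of h] by (simp_all add: \<Delta>_def add.commute algebra_simps)
    then show ?thesis by linarith
  qed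
  then have "\<bar>Q a b - Q b a\<bar> \<le> 0" by (rule field_le_epsilon)
  then show ?thesis by simp
qed

section \<open>The involution and the symplectic form\<close>

lemma R0_component [simp]: "R0 x $ 1 = x $ 1" "R0 x $ 2 = x $ 2" "R0 x $ 3 = - x $ 3" "R0 x $ 4 = - x $ 4"
  by (simp_all add: R0_def)

lemma R0_involution [simp]: "R0 (R0 x) = x"
  by (simp add: vec_eq_iff_4)

lemma R0_fixed_iff: "R0 x = x \<longleftrightarrow> x $ 3 = 0 \<and> x $ 4 = 0"
  by (auto simp: vec_eq_iff_4)

lemma inner_R0: "R0 x \<bullet> y = x \<bullet> R0 y"
  by (simp add: inner_vec_4)

lemma norm_R0 [simp]: "norm (R0 x) = norm x"
  by (simp add: norm_eq_sqrt_inner inner_R0)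

lemma bounded_linear_R0: "bounded_linear R0"
  by (rule bounded_linear_intro[of _ 1]) (simp_all add: vec_eq_iff_4)

lemma R0_0 [simp]: "R0 0 = 0"
  by (simp add: vec_eq_iff_4)

lemma R0_minus: "R0 (- x) = - R0 x"
  by (simp add: vec_eq_iff_4)

lemma R0_scaleR: "R0 (c *\<^sub>R x) = c *\<^sub>R R0 x"
  by (simp add: vec_eq_iff_4)

lemma abs_symplectic_form_le: "\<bar>symplectic_form x y\<bar> \<le> norm x * norm y"
proof -
  have "norm (vector [- x $ 2, x $ 1, - x $ 4, x $ 3] :: real ^ 4) = norm x"
    by (simp add: norm_eq_sqrt_inner inner_vec_4 add_ac)
  moreover have "symplectic_form x y = vector [- x $ 2, x $ 1, - x $ 4, x $ 3] \<bullet> y"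
    by (simp add: symplectic_form_def inner_vec_4)
  ultimately show ?thesis by (metis Cauchy_Schwarz_ineq2)
qed

lemma symplectic_form_simps:
  "symplectic_form (x - y) z = symplectic_form x z - symplectic_form y z"
  "symplectic_form (c *\<^sub>R x) z = c * symplectic_form x z"
  "symplectic_form x (c *\<^sub>R z) = c * symplectic_form x z"
  by (simp_all add: symplectic_form_def algebra_simps)

lemma cos_ge_half: "1 / 2 \<le> cos x" if "\<bar>x\<bar> \<le> pi / 4"
proof -
  have "cos (pi / 4) \<le> cos \<bar>x\<bar>" by (rule cos_monotone_0_pi_le) (use that in auto)
  moreover have "1 / 2 \<le> sqrt 2 / 2" by (rule divide_right_mono) simp_all
  ultimately show ?thesis by (metis cos_45 cos_abs_real order_trans)
qed

text \<open>
  A function with the sign pattern of a sine together with its derivative near \<open>0\<close> and near \<open>\<pi>\<close> has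
  a unique zero in the latter region. The signs on both sides of the zero are recorded because they make
  the zero depend continuously on parameters.
\<close>

lemma first_return_to_zero:
  fixes w :: "real \<Rightarrow> real"
  assumes deriv: "\<And>t. (w has_real_derivative w' t) (at t)" and "w 0 = 0"
    and up: "\<And>t. 0 \<le> t \<Longrightarrow> t \<le> t1 \<Longrightarrow> 0 < w' t"
    and pos: "\<And>t. t1 \<le> t \<Longrightarrow> t \<le> t2 \<Longrightarrow> 0 < w t"
    and down: "\<And>t. t2 \<le> t \<Longrightarrow> t \<le> t3 \<Longrightarrow> w' t < 0"
    and "w t3 < 0" "t1 \<le> t2" "t2 < t3"
  shows "\<exists>\<tau>. t2 < \<tau> \<and> \<tau> < t3 \<and> w \<tau> = 0 \<and> (\<forall>t. 0 < t \<and> t < \<tau> \<longrightarrow> 0 < w t)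
    \<and> (\<forall>t. \<tau> < t \<and> t \<le> t3 \<longrightarrow> w t < 0)"
proof -
  have cont: "continuous_on S w" for S
    using deriv by (meson DERIV_isCont continuous_at_imp_continuous_on)
  have "0 < w t2" using pos assms(7) by simp
  then obtain \<tau> where \<tau>: "t2 \<le> \<tau>" "\<tau> \<le> t3" "w \<tau> = 0"
    using IVT2'[of w t3 0 t2] assms(6,8) cont by force
  have decr: "w b < w a" if "t2 \<le> a" "a < b" "b \<le> t3" for a b
    by (rule DERIV_neg_imp_decreasing[OF that(2)]) (use deriv down that in force)
  have "0 < w t" if "0 < t" "t < \<tau>" for t
  proof -
    consider "t \<le> t1" | "t1 \<le> t" "t \<le> t2" | "t2 \<le> t" by linarith
    then show ?thesis
    proof cases
      case 1
      have "w 0 < w t"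
        by (rule DERIV_pos_imp_increasing[OF that(1)]) (use deriv up 1 in force)
      then show ?thesis using assms(2) by simp
    next
      case 2 then show ?thesis by (rule pos)
    next
      case 3 then show ?thesis using decr[of t \<tau>] that \<tau> by simp
    qed
  qed
  moreover have "w t < 0" if "\<tau> < t" "t \<le> t3" for t
    using decr[of \<tau> t] that \<tau> by simp
  moreover have "\<tau> \<noteq> t2" "\<tau> \<noteq> t3" using \<tau>(3) \<open>0 < w t2\<close> assms(6) by auto
  ultimately show ?thesis using \<tau> by (intro exI[of _ \<tau>]) auto
qed

section \<open>Flow of a reversible centre\<close>

text \<open>
  The Lipschitz condition and reversibility are global, so that the flow exists for all times and is
  reversed by \<open>R0\<close>; a germ satisfies them after composition with the projection to a small ball. The
  field is Hamiltonian near the equilibrium only, which suffices for orbits that stay there.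
\<close>

locale reversible_center =
  fixes F A :: "real ^ 4 \<Rightarrow> real ^ 4" and H :: "real ^ 4 \<Rightarrow> real" and L r \<alpha> :: real
  assumes lipschitz: "\<And>x y. norm (F x - F y) \<le> L * norm (x - y)" and L_pos: "0 < L"
    and F_0: "F 0 = 0" and F_R0: "\<And>x. F (R0 x) = - R0 (F x)"
    and F_deriv: "(F has_derivative A) (at 0)"
    and H_0: "H 0 = 0" and r_pos: "0 < r"
    and H_deriv: "\<And>x. x \<in> ball 0 r \<Longrightarrow> (H has_derivative symplectic_form (F x)) (at x)"
    and \<alpha>_pos: "0 < \<alpha>" and A_squared: "\<And>v. A (A v) = - \<alpha>\<^sup>2 *\<^sub>R v"
    and A_R0: "\<And>v. A (R0 v) = - R0 (A v)"
begin

definition flow :: "real ^ 4 \<Rightarrow> real \<Rightarrow> real ^ 4" where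
  "flow x0 = (SOME x. x 0 = x0 \<and> (\<forall>t. (x has_vector_derivative F (x t)) (at t)))"

lemma flow_0 [simp]: "flow x0 0 = x0"
  and flow_deriv: "(flow x0 has_vector_derivative F (flow x0 t)) (at t)"
  using someI_ex[OF lipschitz_ode_solution[of F L x0, OF lipschitz L_pos]]
  unfolding flow_def by auto

lemma flow_diverge: "norm (flow x t - flow y t) \<le> norm (x - y) * exp ((2 * L + 1) * \<bar>t\<bar>)"
  using ode_solutions_diverge_exponentially[of F L "flow x" "flow y" t, OF lipschitz _ flow_deriv flow_deriv]
    L_pos by simp

lemma flow_unique:
  assumes "\<And>t. (y has_vector_derivative F (y t)) (at t)"
  shows "y t = flow (y 0) t"
  using ode_solutions_diverge_exponentially[of F L y "flow (y 0)" t, OF lipschitz _ assms flow_deriv]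
    L_pos by simp

lemma norm_flow_le: "norm (flow x t) \<le> norm x * exp ((2 * L + 1) * \<bar>t\<bar>)"
proof -
  have "0 = flow 0 t" by (rule flow_unique) (simp add: F_0)
  then show ?thesis using flow_diverge[of x t 0] by simp
qed

lemma flow_flow: "flow (flow x s) t = flow x (s + t)"
proof -
  have "((\<lambda>t. flow x (s + t)) has_vector_derivative F (flow x (s + t))) (at t)" for t
  proof -
    have "((+) s has_vector_derivative 1) (at t)" by (auto intro!: derivative_eq_intros)
    from vector_diff_chain_at[OF this flow_deriv] show ?thesis by (simp add: o_def)
  qed
  from flow_unique[OF this, of t] show ?thesis by simp
qed

lemma flow_R0: "flow (R0 x) t = R0 (flow x (- t))"
proof -
  have "((\<lambda>t. R0 (flow x (- t))) has_vector_derivative F (R0 (flow x (- t)))) (at t)" for t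
    using bounded_linear.has_vector_derivative[OF bounded_linear_R0
        has_vector_derivative_reflect[of "flow x" _ t UNIV]] flow_deriv[of x "- t"]
    by (simp add: F_R0 R0_minus)
  from flow_unique[OF this, of t] show ?thesis by simp
qed

lemma continuous_flow: "continuous_on UNIV (\<lambda>(x, t). flow x t)"
proof -
  have "((\<lambda>(x, t). flow x t) \<longlongrightarrow> flow a b) (at (a, b))" for a b
  proof -
    have "((\<lambda>p. norm (fst p - a) * exp ((2 * L + 1) * \<bar>snd p\<bar>) + norm (flow a (snd p) - flow a b))
        \<longlongrightarrow> norm (a - a) * exp ((2 * L + 1) * \<bar>b\<bar>) + norm (flow a b - flow a b)) (at (a, b))"
    proof (intro tendsto_intros)
      show "((\<lambda>p. fst p) \<longlongrightarrow> a) (at (a, b))" "((\<lambda>p. snd p) \<longlongrightarrow> b) (at (a, b))"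
        by (auto intro!: tendsto_eq_intros)
      have "isCont (flow a) b"
        using has_vector_derivative_continuous[OF flow_deriv] .
      then show "((\<lambda>p. flow a (snd p)) \<longlongrightarrow> flow a b) (at (a, b))"
        by (rule isCont_tendsto_compose) (auto intro!: tendsto_eq_intros)
    qed
    then have lim: "((\<lambda>p. norm (fst p - a) * exp ((2 * L + 1) * \<bar>snd p\<bar>) + norm (flow a (snd p) - flow a b))
        \<longlongrightarrow> 0) (at (a, b))" by simp
    have "norm ((\<lambda>(x, t). flow x t) p - flow a b)
        \<le> norm (fst p - a) * exp ((2 * L + 1) * \<bar>snd p\<bar>) + norm (flow a (snd p) - flow a b)" for p
      using norm_triangle_le[OF add_right_mono[OF flow_diverge[of "fst p" "snd p" a],
            of "norm (flow a (snd p) - flow a b)"]]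
      by (simp add: case_prod_beta)
    then have "((\<lambda>p. (\<lambda>(x, t). flow x t) p - flow a b) \<longlongrightarrow> 0) (at (a, b))"
      by (intro Lim_null_comparison[OF always_eventually lim]) blast
    then show ?thesis by (simp add: LIM_zero_iff)
  qed
  then show ?thesis by (auto simp: continuous_on_eq_continuous_at isCont_def)
qed

lemma continuous_on_flow [continuous_intros]:
  assumes "continuous_on S f" "continuous_on S g"
  shows "continuous_on S (\<lambda>z. flow (f z) (g z))"
  using continuous_on_compose2[OF continuous_flow continuous_on_Pair[OF assms]] by simp

lemma H_flow:
  assumes "0 \<le> t" "\<And>s. 0 \<le> s \<Longrightarrow> s \<le> t \<Longrightarrow> norm (flow x s) < r"
  shows "H (flow x t) = H x"
proof -
  have "((\<lambda>s. H (flow x s)) has_derivative (\<lambda>h. 0)) (at s within {0..t})" if "s \<in> {0..t}" for s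
  proof -
    have "flow x s \<in> ball 0 r" using assms(2) that by simp
    from has_derivative_compose[OF flow_deriv[of x s, unfolded has_vector_derivative_def] H_deriv[OF this]]
    have "((\<lambda>s. H (flow x s)) has_derivative (\<lambda>h. 0)) (at s)"
      by (simp add: symplectic_form_def)
    then show ?thesis by (rule has_derivative_at_withinI)
  qed
  from has_derivative_zero_constant[OF convex_real_interval(5) this] show ?thesis
    using assms(1) by (metis atLeastAtMost_iff flow_0 order_refl)
qed

text \<open>
  On \<open>Fix R0\<close> the field is tangent to the complementary plane, which is \<open>\<omega>\<close>-orthogonal to \<open>Fix R0\<close>;
  so \<open>H\<close> is constant along rays in \<open>Fix R0\<close>.
\<close>

lemma H_fixed:
  assumes "R0 x = x" "norm x < r"
  shows "H x = 0"
proof -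
  have "((\<lambda>s. H (s *\<^sub>R x)) has_derivative (\<lambda>h. 0)) (at s within {0..1})" if "s \<in> {0..1}" for s
  proof -
    have "norm (s *\<^sub>R x) < r"
      using that assms(2) mult_left_le_one_le[of "norm x" s] by auto
    then have "s *\<^sub>R x \<in> ball 0 r" by simp
    moreover have "((\<lambda>s. s *\<^sub>R x) has_derivative (\<lambda>h. h *\<^sub>R x)) (at s)"
      by (auto intro!: derivative_eq_intros)
    ultimately have "((\<lambda>s. H (s *\<^sub>R x)) has_derivative (\<lambda>h. symplectic_form (F (s *\<^sub>R x)) (h *\<^sub>R x))) (at s)"
      using has_derivative_compose[OF _ H_deriv] by fast
    moreover have "symplectic_form (F (s *\<^sub>R x)) x = 0"
    proof -
      have "F (s *\<^sub>R x) = - R0 (F (s *\<^sub>R x))" using F_R0[of "s *\<^sub>R x"] assms(1) by (simp add: R0_scaleR)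
      then show ?thesis using assms(1) by (simp add: vec_eq_iff_4 symplectic_form_def)
    qed
    ultimately show ?thesis
      by (simp add: symplectic_form_simps has_derivative_at_withinI)
  qed
  from has_derivative_zero_constant[OF convex_real_interval(5) this] show ?thesis
    using H_0 by (metis atLeastAtMost_iff order_refl scaleR_one scaleR_zero_left zero_le_one)
qed

lemma linear_A: "linear A"
  using has_derivative_linear[OF F_deriv] .

text \<open>
  The closed form of \<open>exp (t A) u\<close> that results from \<open>A\<^sup>2 = - \<alpha>\<^sup>2\<close>.
\<close>

definition linear_flow :: "real ^ 4 \<Rightarrow> real \<Rightarrow> real ^ 4" where
  "linear_flow u t = cos (\<alpha> * t) *\<^sub>R u + (sin (\<alpha> * t) / \<alpha>) *\<^sub>R A u"

lemma A_linear_flow: "A (linear_flow u t) = cos (\<alpha> * t) *\<^sub>R A u - (\<alpha> * sin (\<alpha> * t)) *\<^sub>R u"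
  using \<alpha>_pos by (simp add: linear_flow_def linear_add[OF linear_A] linear_cmul[OF linear_A] A_squared power2_eq_square)

lemma linear_flow_deriv: "(linear_flow u has_vector_derivative A (linear_flow u t)) (at t)"
  unfolding A_linear_flow unfolding linear_flow_def
  using \<alpha>_pos by (auto intro!: derivative_eq_intros simp: algebra_simps)

text \<open>
  Along \<open>s\<close> times the linear orbit, the nonlinear field differs from the linear one by \<open>o(s)\<close>; the
  inhomogeneous Gronwall inequality carries this over to the orbits, and the Lipschitz condition to their
  velocities.
\<close>

lemma flow_near_linear_flow:
  assumes "0 < e"
  shows "\<exists>\<delta>>0. \<forall>s t. 0 < s \<and> s < \<delta> \<and> 0 \<le> t \<and> t \<le> T \<longrightarrow>
    norm (flow (s *\<^sub>R u) t - s *\<^sub>R linear_flow u t) \<le> e * s \<and>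
    norm (F (flow (s *\<^sub>R u) t) - s *\<^sub>R A (linear_flow u t)) \<le> e * s"
proof -
  define K where "K = norm u + norm (A u) / \<alpha> + 1"
  define E where "E = exp ((2 * L + 1) * \<bar>T\<bar>)"
  define e1 where "e1 = e / (2 * (L + 1) * K * E)"
  have K: "0 < K" using \<alpha>_pos by (simp add: K_def add_nonneg_pos)
  have E: "1 \<le> E" using L_pos by (simp add: E_def)
  have e1: "0 < e1" using assms K E L_pos by (simp add: e1_def)
  from F_deriv[unfolded has_derivative_at_alt, THEN conjunct2, rule_format, OF e1] F_0
  obtain d where d: "0 < d" "\<And>y. norm y < d \<Longrightarrow> norm (F y - A y) \<le> e1 * norm y"
    by auto
  have bound_linear: "norm (linear_flow u t) \<le> K" for t
  proof -
    have "norm (linear_flow u t) \<le> \<bar>cos (\<alpha> * t)\<bar> * norm u + \<bar>sin (\<alpha> * t)\<bar> * (norm (A u) / \<alpha>)"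
      unfolding linear_flow_def by (rule norm_triangle_le) (use \<alpha>_pos in simp)
    also have "\<dots> \<le> 1 * norm u + 1 * (norm (A u) / \<alpha>)"
      using \<alpha>_pos by (intro add_mono mult_right_mono) auto
    finally show ?thesis by (simp add: K_def)
  qed
  have "norm (flow (s *\<^sub>R u) t - s *\<^sub>R linear_flow u t) \<le> e * s \<and>
      norm (F (flow (s *\<^sub>R u) t) - s *\<^sub>R A (linear_flow u t)) \<le> e * s"
    if s: "0 < s" "s < d / K" and t: "0 \<le> t" "t \<le> T" for s t
  proof -
    define \<eta> where "\<eta> = e1 * K * s"
    have \<eta>: "0 \<le> \<eta>" using e1 K s by (simp add: \<eta>_def)
    have residual: "norm (F (s *\<^sub>R linear_flow u t) - s *\<^sub>R A (linear_flow u t)) \<le> \<eta>" for t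
    proof -
      have le: "norm (s *\<^sub>R linear_flow u t) \<le> s * K"
        using bound_linear s(1) by (simp add: mult_left_mono)
      also have "\<dots> < d" using s K by (simp add: field_simps)
      finally have "norm (F (s *\<^sub>R linear_flow u t) - A (s *\<^sub>R linear_flow u t)) \<le> e1 * norm (s *\<^sub>R linear_flow u t)"
        by (rule d(2))
      also have "\<dots> \<le> \<eta>"
        using mult_left_mono[OF le, of e1] e1 by (simp add: \<eta>_def algebra_simps)
      finally show ?thesis by (simp add: linear_cmul[OF linear_A])
    qed
    define v where "v t = flow (s *\<^sub>R u) t - s *\<^sub>R linear_flow u t" for t
    define v' where "v' t = F (flow (s *\<^sub>R u) t) - s *\<^sub>R A (linear_flow u t)" for t
    have v_deriv: "(v has_vector_derivative v' t) (at t)" for t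
      unfolding v_def v'_def by (auto intro!: derivative_eq_intros flow_deriv linear_flow_deriv)
    have v'_le: "norm (v' t) \<le> L * norm (v t) + \<eta>" for t
    proof -
      have "norm (v' t) \<le> norm (F (flow (s *\<^sub>R u) t) - F (s *\<^sub>R linear_flow u t))
          + norm (F (s *\<^sub>R linear_flow u t) - s *\<^sub>R A (linear_flow u t))"
        unfolding v'_def
        using norm_triangle_ineq[of "F (flow (s *\<^sub>R u) t) - F (s *\<^sub>R linear_flow u t)"
            "F (s *\<^sub>R linear_flow u t) - s *\<^sub>R A (linear_flow u t)"] by simp
      also have "\<dots> \<le> L * norm (v t) + \<eta>"
        unfolding v_def by (intro add_mono lipschitz residual)
      finally show ?thesis .
    qed
    have "v 0 = 0" by (simp add: v_def linear_flow_def)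
    then have "(norm (v t))\<^sup>2 + \<eta>\<^sup>2 \<le> \<eta>\<^sup>2 * exp ((2 * L + 1) * t)"
      using gronwall_norm_square[of T v v' L \<eta> t, OF v_deriv v'_le t] L_pos by simp
    then have "(norm (v t))\<^sup>2 \<le> \<eta>\<^sup>2 * exp ((2 * L + 1) * t)"
      using zero_le_power2[of \<eta>] by linarith
    also have "\<dots> \<le> \<eta>\<^sup>2 * E\<^sup>2"
    proof (rule mult_left_mono)
      have "exp ((2 * L + 1) * t) \<le> E" using t L_pos by (simp add: E_def)
      also have "\<dots> \<le> E\<^sup>2" using E by (simp add: power2_eq_square)
      finally show "exp ((2 * L + 1) * t) \<le> E\<^sup>2" .
    qed simp
    finally have "norm (v t) \<le> \<eta> * E"
      by (intro power2_le_imp_le[of "norm (v t)" "\<eta> * E"] mult_nonneg_nonneg \<eta>)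
        (use E in \<open>simp_all add: power_mult_distrib\<close>)
    moreover have \<eta>E: "\<eta> * E = e * s / (2 * (L + 1))"
      using K E L_pos by (simp add: \<eta>_def e1_def)
    ultimately have v: "norm (v t) \<le> e * s / (2 * (L + 1))" by simp
    have es: "0 < e * s" using assms s by simp
    have "e * s / (2 * (L + 1)) \<le> e * s"
      using es L_pos by (simp add: field_simps)
    moreover have "norm (v' t) \<le> e * s"
    proof -
      have "\<eta> \<le> \<eta> * E" using \<eta> E by (simp add: mult_le_cancel_left1)
      then have "norm (v' t) \<le> L * (e * s / (2 * (L + 1))) + e * s / (2 * (L + 1))"
        using v'_le[of t] mult_left_mono[OF v, of L] L_pos \<eta>E by linarith
      also have "\<dots> = (L + 1) * (e * s / (2 * (L + 1)))" by (simp only: distrib_right mult_1)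
      also have "\<dots> = e * s / 2" using L_pos by (simp add: field_simps)
      finally show ?thesis using es by simp
    qed
    ultimately show ?thesis using v by (simp add: v_def v'_def)
  qed
  then show ?thesis using d(1) K by (intro exI[of _ "d / K"]) auto
qed

lemma A_fixed:
  assumes "R0 u = u"
  shows "A u $ 1 = 0" "A u $ 2 = 0"
proof -
  have "A u = - R0 (A u)" using A_R0[of u] assms by simp
  then show "A u $ 1 = 0" "A u $ 2 = 0" by (simp_all add: vec_eq_iff_4)
qed

section \<open>Return to the symmetry plane\<close>

text \<open>
  Energy replaces one of the two equations for a return to \<open>Fix R0\<close>. Write \<open>x = p + q\<close> with \<open>p\<close>
  in \<open>Fix R0\<close> and \<open>q\<close> in the complementary plane. Since \<open>H p = 0 = H x\<close>, Rolle's theorem gives a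
  point \<open>y\<close> between \<open>p\<close> and \<open>x\<close> where \<open>dH y q = \<omega> (F y, q)\<close> vanishes. But \<open>F y\<close> is close to
  \<open>c n - d u\<close>; the vectors \<open>u\<close> and \<open>q\<close> are \<open>\<omega>\<close>-orthogonal, while \<open>n\<close> and \<open>q\<close> are perpendicular in
  one and the same symplectic plane, so that \<open>|\<omega> (n, q)| = |n| |q|\<close>. With errors below \<open>|c| |n|\<close> this forces \<open>q = 0\<close>.
\<close>

lemma fixed_of_energy_zero:
  assumes x: "norm x < r" "H x = 0" and n: "R0 n = - n" "x \<bullet> n = 0" "n \<noteq> 0"
    and u: "R0 u = u"
    and near: "norm (x - (a *\<^sub>R u + b *\<^sub>R n)) \<le> e" "norm (F x - (c *\<^sub>R n - d *\<^sub>R u)) \<le> e"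
    and e: "(L + 1) * e < \<bar>c\<bar> * norm n"
  shows "R0 x = x"
proof (rule ccontr)
  assume "R0 x \<noteq> x"
  have n12: "n $ 1 = 0" "n $ 2 = 0" using n(1) by (simp_all add: vec_eq_iff_4)
  have u34: "u $ 3 = 0" "u $ 4 = 0" using u by (simp_all add: R0_fixed_iff)
  define p q :: "real ^ 4" where "p = vector [x $ 1, x $ 2, 0, 0]" and "q = vector [0, 0, x $ 3, x $ 4]"
  have x_eq: "x = p + q" by (simp add: p_def q_def vec_eq_iff_4)
  have q0: "q \<noteq> 0" using \<open>R0 x \<noteq> x\<close> by (auto simp: q_def R0_fixed_iff vec_eq_iff_4)
  have nx: "(norm x)\<^sup>2 = (norm p)\<^sup>2 + (norm q)\<^sup>2"
    by (simp add: power2_norm_eq_inner inner_vec_4 p_def q_def)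
  have norm_seg: "norm (p + t *\<^sub>R q) \<le> norm x" if "0 \<le> t" "t \<le> 1" for t
  proof (rule power2_le_imp_le)
    have "(norm (p + t *\<^sub>R q))\<^sup>2 = (norm p)\<^sup>2 + t\<^sup>2 * (norm q)\<^sup>2"
      unfolding power2_norm_eq_inner by (simp add: inner_vec_4 p_def q_def algebra_simps power2_eq_square)
    also have "\<dots> \<le> (norm p)\<^sup>2 + 1 * (norm q)\<^sup>2"
      using that by (intro add_left_mono mult_right_mono power_le_one) auto
    finally show "(norm (p + t *\<^sub>R q))\<^sup>2 \<le> (norm x)\<^sup>2" using nx by simp
  qed simp
  define g where "g t = H (p + t *\<^sub>R q)" for t
  have g_deriv: "(g has_real_derivative symplectic_form (F (p + t *\<^sub>R q)) q) (at t)" if t: "0 \<le> t" "t \<le> 1" for t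
  proof -
    have "((\<lambda>t. p + t *\<^sub>R q) has_derivative (\<lambda>h. h *\<^sub>R q)) (at t)"
      by (auto intro!: derivative_eq_intros)
    moreover have "p + t *\<^sub>R q \<in> ball 0 r" using norm_seg[OF t] x(1) by simp
    ultimately have "(g has_derivative (\<lambda>h. symplectic_form (F (p + t *\<^sub>R q)) (h *\<^sub>R q))) (at t)"
      unfolding g_def using has_derivative_compose[OF _ H_deriv] by fast
    then show ?thesis
      unfolding has_field_derivative_def by (rule has_derivative_eq_rhs) (simp add: fun_eq_iff symplectic_form_simps)
  qed
  have "g 0 = 0"
    unfolding g_def using H_fixed[of p] norm_seg[of 0] x(1) by (simp add: R0_fixed_iff p_def)
  moreover have "g 1 = 0" using x(2) x_eq by (simp add: g_def)
  ultimately obtain t where t: "0 < t" "t < 1" and "symplectic_form (F (p + t *\<^sub>R q)) q = 0"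
    using MVT2[OF zero_less_one g_deriv] by force
  define y z where "y = p + t *\<^sub>R q" and "z = c *\<^sub>R n - d *\<^sub>R u"
  have "norm q \<le> e"
  proof -
    have "norm q * norm q = q \<bullet> q" by (simp add: norm_eq_sqrt_inner)
    also have "\<dots> = q \<bullet> (x - (a *\<^sub>R u + b *\<^sub>R n))"
      using n(2) by (simp add: inner_vec_4 q_def n12 u34 algebra_simps) algebra
    also have "\<dots> \<le> norm q * e"
      using norm_cauchy_schwarz[of q] mult_left_mono[OF near(1), of "norm q"] by (rule order_trans) simp
    finally show ?thesis using q0 by simp
  qed
  moreover have "norm (y - x) \<le> norm q"
  proof -
    have "y - x = (t - 1) *\<^sub>R q" by (simp add: y_def x_eq algebra_simps)
    then show ?thesis using t by (simp add: mult_left_le_one_le)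
  qed
  ultimately have "L * norm (y - x) \<le> L * e" using L_pos by simp
  have Fy: "norm (F y - z) \<le> (L + 1) * e"
  proof -
    have "norm (F y - z) \<le> norm (F y - F x) + norm (F x - z)"
      using norm_triangle_ineq[of "F y - F x" "F x - z"] by simp
    then show ?thesis
      using lipschitz[of y x] near(2) \<open>L * norm (y - x) \<le> L * e\<close>
      unfolding z_def distrib_right by linarith
  qed
  have "symplectic_form (F y) q = 0" unfolding y_def by fact
  then have "\<bar>symplectic_form z q\<bar> = \<bar>symplectic_form (F y - z) q\<bar>"
    by (simp add: symplectic_form_simps)
  also have "\<dots> \<le> norm (F y - z) * norm q" by (rule abs_symplectic_form_le)
  also have "\<dots> \<le> (L + 1) * e * norm q" by (rule mult_right_mono[OF Fy]) simp
  also have "\<dots> < \<bar>c\<bar> * norm n * norm q" using e q0 by simp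
  finally have 1: "\<bar>symplectic_form z q\<bar> < \<bar>c\<bar> * norm n * norm q" .
  have "(symplectic_form n q)\<^sup>2 = (norm n * norm q)\<^sup>2"
  proof -
    have "n \<bullet> q = 0" using n(2) n12 by (simp add: inner_vec_4 q_def mult.commute)
    moreover have "(symplectic_form n q)\<^sup>2 + (n \<bullet> q)\<^sup>2 = (norm n)\<^sup>2 * (norm q)\<^sup>2"
      unfolding power2_norm_eq_inner
      by (simp add: symplectic_form_def inner_vec_4 n12 q_def) algebra
    ultimately show ?thesis by (simp add: power_mult_distrib)
  qed
  then have "\<bar>symplectic_form n q\<bar> = norm n * norm q"
    by (intro power2_eq_imp_eq[of "\<bar>symplectic_form n q\<bar>"]) simp_all
  moreover have "symplectic_form z q = c * symplectic_form n q"
    by (simp add: z_def symplectic_form_def q_def u34 algebra_simps)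
  ultimately have 2: "\<bar>symplectic_form z q\<bar> = \<bar>c\<bar> * norm n * norm q" by (simp add: abs_mult)
  with 1 2 show False by simp
qed

text \<open>
  For times in the window \<open>[3 \<pi> / 4, 5 \<pi> / 4] / \<alpha>\<close> one has \<open>cos (\<alpha> t) \<le> - 1 / 2\<close>, so the component of
  the orbit along \<open>A u\<close> crosses zero there with negative slope. The negative component along \<open>u\<close>
  at that time distinguishes the return point from the starting point.
\<close>

lemma half_return:
  assumes u: "R0 u = u" "norm u = 1"
  shows "\<exists>\<delta>>0. \<forall>s. 0 < s \<and> s < \<delta> \<longrightarrow>
    s * exp ((2 * L + 1) * (5 * pi / (4 * \<alpha>))) < r \<and>
    (\<exists>\<tau>. 3 * pi / (4 * \<alpha>) < \<tau> \<and> \<tau> < 5 * pi / (4 * \<alpha>) \<and>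
      (\<forall>t. 0 < t \<and> t < \<tau> \<longrightarrow> 0 < flow (s *\<^sub>R u) t \<bullet> A u) \<and>
      (\<forall>t. \<tau> < t \<and> t \<le> 5 * pi / (4 * \<alpha>) \<longrightarrow> flow (s *\<^sub>R u) t \<bullet> A u < 0) \<and>
      R0 (flow (s *\<^sub>R u) \<tau>) = flow (s *\<^sub>R u) \<tau> \<and> flow (s *\<^sub>R u) \<tau> \<bullet> u < 0)"
proof -
  define t1 t2 t3 where "t1 = pi / (4 * \<alpha>)" and "t2 = 3 * pi / (4 * \<alpha>)" and "t3 = 5 * pi / (4 * \<alpha>)"
  define n where "n = A u"
  define N where "N = norm n"
  define E where "E = exp ((2 * L + 1) * t3)"
  have t: "0 < t1" "t1 \<le> t2" "t2 < t3" using \<alpha>_pos by (simp_all add: t1_def t2_def t3_def divide_simps)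
  have n_R0: "R0 n = - n" using A_R0[of u] u(1) by (metis minus_minus n_def)
  have "A n = - \<alpha>\<^sup>2 *\<^sub>R u" by (simp add: n_def A_squared)
  then have n0: "n \<noteq> 0" using u(2) \<alpha>_pos linear_0[OF linear_A] by auto
  then have N: "0 < N" by (simp add: N_def)
  have un: "u \<bullet> n = 0"
    using A_fixed[OF u(1)] u(1) by (simp add: inner_vec_4 n_def R0_fixed_iff)
  have uu: "u \<bullet> u = 1" using u(2) by (simp add: norm_eq_1)
  have nn: "n \<bullet> n = N\<^sup>2" by (simp add: N_def power2_norm_eq_inner)
  \<comment> \<open>The three bounds serve, in this order, the transversality of the energy level and the sign
      of \<open>w'\<close>, the sign of \<open>w\<close>, and the sign of the component along \<open>u\<close>.\<close>
  define e where "e = min (N / (4 * (L + 1))) (min (N / (4 * \<alpha>)) (1 / 4))"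
  have e: "0 < e" using N L_pos \<alpha>_pos by (simp add: e_def)
  have e_N: "(L + 1) * e \<le> N / 4" 
  proof -
    have "(L + 1) * e \<le> (L + 1) * (N / (4 * (L + 1)))"
      by (rule mult_left_mono) (use L_pos in \<open>auto simp: e_def\<close>)
    also have "\<dots> = N / 4" using L_pos by (simp add: field_simps)
    finally show ?thesis .
  qed
  have e_le: "e \<le> N / 4" using e_N mult_nonneg_nonneg[of L e] L_pos e unfolding distrib_right by linarith
  have e_\<alpha>: "e \<le> N / (4 * \<alpha>)" "e \<le> 1 / 4" unfolding e_def by linarith+
  obtain \<delta> where \<delta>: "0 < \<delta>" and close: "\<And>s t. 0 < s \<Longrightarrow> s < \<delta> \<Longrightarrow> 0 \<le> t \<Longrightarrow> t \<le> t3 \<Longrightarrow>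
    norm (flow (s *\<^sub>R u) t - s *\<^sub>R linear_flow u t) \<le> e * s \<and>
    norm (F (flow (s *\<^sub>R u) t) - s *\<^sub>R A (linear_flow u t)) \<le> e * s"
    using flow_near_linear_flow[OF e, where u = u and T = t3] by blast
  have inner_close: "\<bar>a \<bullet> m - b \<bullet> m\<bar> \<le> e * s * norm m" if "norm (a - b) \<le> e * s" for a b m :: "real ^ 4" and s
  proof -
    have "\<bar>(a - b) \<bullet> m\<bar> \<le> norm (a - b) * norm m" by (rule Cauchy_Schwarz_ineq2)
    also have "\<dots> \<le> e * s * norm m" by (rule mult_right_mono[OF that]) simp
    finally show ?thesis by (simp add: inner_diff_left)
  qed
  have "s * E < r \<and>
    (\<exists>\<tau>. t2 < \<tau> \<and> \<tau> < t3 \<and>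
      (\<forall>t. 0 < t \<and> t < \<tau> \<longrightarrow> 0 < flow (s *\<^sub>R u) t \<bullet> n) \<and>
      (\<forall>t. \<tau> < t \<and> t \<le> t3 \<longrightarrow> flow (s *\<^sub>R u) t \<bullet> n < 0) \<and>
      R0 (flow (s *\<^sub>R u) \<tau>) = flow (s *\<^sub>R u) \<tau> \<and> flow (s *\<^sub>R u) \<tau> \<bullet> u < 0)"
    if s: "0 < s" "s < min \<delta> (r / E)" for s
  proof -
    have sE: "s * E < r" using s by (simp add: E_def field_simps)
    have s\<delta>: "s < \<delta>" using s by simp
    \<comment> \<open>For the linear flow, \<open>w / s\<close> would be \<open>sin (\<alpha> t) / \<alpha>\<close> times \<open>N\<^sup>2\<close> and \<open>w' / s\<close> would be
        \<open>cos (\<alpha> t)\<close> times \<open>N\<^sup>2\<close>; the error \<open>e N\<close> is below half of these amplitudes.\<close>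
    define w where "w t = flow (s *\<^sub>R u) t \<bullet> n" for t
    define w' where "w' t = F (flow (s *\<^sub>R u) t) \<bullet> n" for t
    have w_deriv: "(w has_real_derivative w' t) (at t)" for t
      using bounded_linear.has_vector_derivative[OF bounded_linear_inner_left flow_deriv[of "s *\<^sub>R u" t], of n]
      unfolding w_def w'_def has_real_derivative_iff_has_vector_derivative .
    have w_close: "\<bar>w t - s * (sin (\<alpha> * t) / \<alpha> * N\<^sup>2)\<bar> \<le> e * s * N" if "0 \<le> t" "t \<le> t3" for t
      using inner_close[OF conjunct1[OF close[OF s(1) s\<delta> that]], of n]
      by (simp add: w_def linear_flow_def un nn inner_add_left flip: n_def N_def)
    have w'_close: "\<bar>w' t - s * (cos (\<alpha> * t) * N\<^sup>2)\<bar> \<le> e * s * N" if "0 \<le> t" "t \<le> t3" for t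
      using inner_close[OF conjunct2[OF close[OF s(1) s\<delta> that]], of n]
      by (simp add: w'_def A_linear_flow un nn inner_diff_left flip: n_def N_def)
    have small: "e * s * N < s * (1 / 2 * N\<^sup>2)" "e * s * N < s * (1 / 2 / \<alpha> * N\<^sup>2)"
    proof -
      have sN: "0 < s * N * N" using s N by simp
      have "e * s * N \<le> (N / 4) * s * N" using e_le s N by (intro mult_right_mono) auto
      also have "\<dots> = s * N * N * (1 / 4)" by simp
      also have "\<dots> < s * N * N * (1 / 2)" by (rule mult_strict_left_mono) (use sN in simp_all)
      finally show "e * s * N < s * (1 / 2 * N\<^sup>2)" by (simp add: power2_eq_square mult_ac)
      have "e * s * N \<le> (N / (4 * \<alpha>)) * s * N" using e_\<alpha> s N by (intro mult_right_mono) auto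
      also have "\<dots> = s * N * N / \<alpha> * (1 / 4)" by (simp add: mult_ac)
      also have "\<dots> < s * N * N / \<alpha> * (1 / 2)"
        by (rule mult_strict_left_mono) (use sN \<alpha>_pos in simp_all)
      finally show "e * s * N < s * (1 / 2 / \<alpha> * N\<^sup>2)" by (simp add: power2_eq_square mult_ac)
    qed
    have cos_pos: "1 / 2 \<le> cos (\<alpha> * t)" if "0 \<le> t" "t \<le> t1" for t
      by (rule cos_ge_half) (use that \<alpha>_pos in \<open>simp add: t1_def field_simps\<close>)
    have sin_pos: "1 / 2 \<le> sin (\<alpha> * t)" if "t1 \<le> t" "t \<le> t2" for t
    proof -
      have "pi / 4 \<le> \<alpha> * t" "\<alpha> * t \<le> 3 * pi / 4"
        using that \<alpha>_pos by (simp_all add: t1_def t2_def field_simps)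
      then have "\<bar>\<alpha> * t - pi / 2\<bar> \<le> pi / 4" by (simp only: abs_le_iff) linarith
      from cos_ge_half[OF this] show ?thesis by (simp add: cos_diff)
    qed
    have cos_neg: "cos (\<alpha> * t) \<le> - (1 / 2)" if "t2 \<le> t" "t \<le> t3" for t
    proof -
      have "3 * pi / 4 \<le> \<alpha> * t" "\<alpha> * t \<le> 5 * pi / 4"
        using that \<alpha>_pos by (simp_all add: t2_def t3_def field_simps)
      then have "\<bar>\<alpha> * t - pi\<bar> \<le> pi / 4" by (simp only: abs_le_iff) linarith
      from cos_ge_half[OF this] show ?thesis by (simp add: cos_diff)
    qed
    have scale: "s * (c / \<alpha> * N\<^sup>2) \<le> s * (d / \<alpha> * N\<^sup>2)" "s * (c * N\<^sup>2) \<le> s * (d * N\<^sup>2)" if "c \<le> d" for c d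
      using that s \<alpha>_pos by (auto intro!: mult_left_mono mult_right_mono divide_right_mono)
    have "\<exists>\<tau>. t2 < \<tau> \<and> \<tau> < t3 \<and> w \<tau> = 0 \<and> (\<forall>t. 0 < t \<and> t < \<tau> \<longrightarrow> 0 < w t)
        \<and> (\<forall>t. \<tau> < t \<and> t \<le> t3 \<longrightarrow> w t < 0)"
    proof (rule first_return_to_zero[OF w_deriv _ _ _ _ _ t(2,3)])
      show "w 0 = 0" by (simp add: w_def un)
      show "0 < w' t" if "0 \<le> t" "t \<le> t1" for t
        using w'_close[of t] scale(2)[OF cos_pos[OF that]] small(1) that t by simp
      show "0 < w t" if "t1 \<le> t" "t \<le> t2" for t
        using w_close[of t] scale(1)[OF sin_pos[OF that]] small(2) that t by simp
      show "w' t < 0" if "t2 \<le> t" "t \<le> t3" for t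
        using w'_close[of t] scale(2)[OF cos_neg[OF that]] small(1) that t by simp
      have "sin (\<alpha> * t3) \<le> - (1 / 2)"
      proof -
        have "\<alpha> * t3 = pi / 4 + pi" using \<alpha>_pos by (simp add: t3_def field_simps)
        then have "sin (\<alpha> * t3) = - cos (pi / 4)" by (simp only: sin_periodic_pi sin_45 cos_45)
        then show ?thesis using cos_ge_half[of "pi / 4"] by simp
      qed
      then show "w t3 < 0"
        using w_close[of t3] scale(1)[of "sin (\<alpha> * t3)" "- (1 / 2)"] small(2) t by simp
    qed
    then obtain \<tau> where \<tau>: "t2 < \<tau>" "\<tau> < t3" "w \<tau> = 0" "\<forall>t. 0 < t \<and> t < \<tau> \<longrightarrow> 0 < w t"
      "\<forall>t. \<tau> < t \<and> t \<le> t3 \<longrightarrow> w t < 0" by blast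
    have \<tau>03: "0 \<le> \<tau>" "\<tau> \<le> t3" using \<tau> t by auto
    define x where "x = flow (s *\<^sub>R u) \<tau>"
    have c: "cos (\<alpha> * \<tau>) \<le> - (1 / 2)" using cos_neg \<tau> by simp
    have norm_lt: "norm (flow (s *\<^sub>R u) t) < r" if "0 \<le> t" "t \<le> t3" for t
    proof -
      have "norm (flow (s *\<^sub>R u) t) \<le> s * exp ((2 * L + 1) * t)"
        using norm_flow_le[of "s *\<^sub>R u" t] u(2) s(1) that by simp
      also have "\<dots> \<le> s * E"
        using that L_pos s(1) by (simp add: E_def)
      finally show ?thesis using sE by simp
    qed
    note x_close = close[OF s(1) s\<delta> \<tau>03, folded x_def]
    have "R0 x = x"
    proof (rule fixed_of_energy_zero[where n = n and u = u and e = "e * s"])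
      show "norm x < r" unfolding x_def by (rule norm_lt[OF \<tau>03])
      have "H x = H (s *\<^sub>R u)"
        unfolding x_def by (rule H_flow[OF \<tau>03(1)]) (use norm_lt \<tau>03 in auto)
      also have "\<dots> = 0"
        by (rule H_fixed) (use u norm_lt[of 0] t in \<open>simp_all add: R0_scaleR\<close>)
      finally show "H x = 0" .
      show "x \<bullet> n = 0" using \<tau>(3) by (simp add: w_def x_def)
      show "norm (x - ((s * cos (\<alpha> * \<tau>)) *\<^sub>R u + (s * (sin (\<alpha> * \<tau>) / \<alpha>)) *\<^sub>R n)) \<le> e * s"
        using conjunct1[OF x_close] by (simp add: linear_flow_def n_def scaleR_add_right)
      show "norm (F x - ((s * cos (\<alpha> * \<tau>)) *\<^sub>R n - (s * (\<alpha> * sin (\<alpha> * \<tau>))) *\<^sub>R u)) \<le> e * s"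
        using conjunct2[OF x_close] by (simp add: A_linear_flow n_def scaleR_diff_right)
      have "(L + 1) * (e * s) \<le> N / 4 * s" using mult_right_mono[OF e_N, of s] s(1) by simp
      also have "\<dots> < s * (1 / 2) * N" using s(1) N by simp
      also have "\<dots> \<le> s * \<bar>cos (\<alpha> * \<tau>)\<bar> * N"
        using c s(1) N by (intro mult_right_mono mult_left_mono) auto
      also have "\<dots> = \<bar>s * cos (\<alpha> * \<tau>)\<bar> * N" using s(1) by (simp add: abs_mult)
      finally show "(L + 1) * (e * s) < \<bar>s * cos (\<alpha> * \<tau>)\<bar> * norm n" by (simp add: N_def)
    qed (use n_R0 n0 u in auto)
    moreover have "x \<bullet> u < 0"
    proof -
      have "\<bar>x \<bullet> u - s * cos (\<alpha> * \<tau>)\<bar> \<le> e * s"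
        using inner_close[OF conjunct1[OF x_close], of u] un uu u(2)
        by (simp add: linear_flow_def inner_add_left inner_commute[of n u] flip: n_def)
      moreover have "s * cos (\<alpha> * \<tau>) \<le> s * - (1 / 2)" using c s(1) by (intro mult_left_mono) auto
      moreover have "e * s \<le> 1 / 4 * s" using e_\<alpha>(2) s(1) by (intro mult_right_mono) auto
      ultimately show ?thesis using s(1) by linarith
    qed
    ultimately show ?thesis
      using sE \<tau> by (auto simp: w_def x_def)
  qed
  then show ?thesis
    using \<delta> r_pos unfolding t2_def t3_def n_def E_def
    by (intro exI[of _ "min \<delta> (r / exp ((2 * L + 1) * (5 * pi / (4 * \<alpha>))))"]) simp
qed

section \<open>Families of symmetric periodic orbits\<close>

text \<open>
  Reflecting in the two points of the orbit on \<open>Fix R0\<close> reverses time about \<open>0\<close> and about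
  \<open>\<tau>\<close>; the composition is the time shift by \<open>2 \<tau>\<close>.
\<close>

lemma flow_periodic:
  assumes "R0 x = x" "R0 (flow x \<tau>) = flow x \<tau>"
  shows "flow x (t + 2 * \<tau>) = flow x t"
proof -
  have "flow x (t + 2 * \<tau>) = flow (flow x \<tau>) (\<tau> + t)"
    unfolding flow_flow by (rule arg_cong[of _ _ "flow x"]) simp
  also have "\<dots> = R0 (flow (flow x \<tau>) (- (\<tau> + t)))" 
    using flow_R0[of "flow x \<tau>" "\<tau> + t"] unfolding assms(2) .
  also have "\<dots> = R0 (flow x (- t))" unfolding flow_flow by simp
  also have "\<dots> = flow x t" using flow_R0[of x t] unfolding assms(1) by (rule sym)
  finally show ?thesis .
qed

lemma flow_reduce_time:
  assumes "R0 x = x" "R0 (flow x \<tau>) = flow x \<tau>" "0 < \<tau>"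
  obtains t' where "\<bar>t'\<bar> \<le> \<tau>" "flow x t = flow x t'"
proof -
  interpret periodic_fun_simple "flow x" "2 * \<tau>"
    by unfold_locales (rule flow_periodic[OF assms(1,2)])
  define k where "k = \<lfloor>(t + \<tau>) / (2 * \<tau>)\<rfloor>"
  have "of_int k \<le> (t + \<tau>) / (2 * \<tau>)" "(t + \<tau>) / (2 * \<tau>) < of_int k + 1"
    unfolding k_def by linarith+
  then have "\<bar>t - of_int k * (2 * \<tau>)\<bar> \<le> \<tau>"
    using assms(3) by (simp add: field_simps abs_le_iff)
  moreover have "flow x t = flow x (t - of_int k * (2 * \<tau>))" by (rule minus_of_int[symmetric])
  ultimately show ?thesis by (rule that)
qed

text \<open>
  The last clause says that \<open>s u\<close> is the only point of the orbit on \<open>Fix R0\<close> with nonnegative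
  component along \<open>u\<close>. It identifies the orbit by its parameter, within the family as well as against
  families with other directions.
\<close>

lemma symmetric_periodic_family_flow:
  assumes u: "R0 u = u" "norm u = 1"
  shows "\<exists>\<delta>. symmetric_periodic_family F \<delta> (\<lambda>s. flow (s *\<^sub>R u)) \<and>
    (\<forall>s\<in>{0<..<\<delta>}. \<forall>t. norm (flow (s *\<^sub>R u) t) < r \<and>
      (R0 (flow (s *\<^sub>R u) t) = flow (s *\<^sub>R u) t \<and> 0 \<le> flow (s *\<^sub>R u) t \<bullet> u
        \<longrightarrow> flow (s *\<^sub>R u) t = s *\<^sub>R u))"
proof -
  define t3 where "t3 = 5 * pi / (4 * \<alpha>)"
  define E where "E = exp ((2 * L + 1) * t3)"
  define w where "w s t = flow (s *\<^sub>R u) t \<bullet> A u" for s t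
  obtain \<delta> where \<delta>: "0 < \<delta>" and half: "\<forall>s. 0 < s \<and> s < \<delta> \<longrightarrow> s * E < r \<and>
    (\<exists>\<tau>. 3 * pi / (4 * \<alpha>) < \<tau> \<and> \<tau> < t3 \<and>
      (\<forall>t. 0 < t \<and> t < \<tau> \<longrightarrow> 0 < w s t) \<and> (\<forall>t. \<tau> < t \<and> t \<le> t3 \<longrightarrow> w s t < 0) \<and>
      R0 (flow (s *\<^sub>R u) \<tau>) = flow (s *\<^sub>R u) \<tau> \<and> flow (s *\<^sub>R u) \<tau> \<bullet> u < 0)"
    using half_return[OF u] unfolding t3_def E_def w_def by blast
  then obtain \<tau> where \<tau>: "\<And>s. 0 < s \<Longrightarrow> s < \<delta> \<Longrightarrow> 3 * pi / (4 * \<alpha>) < \<tau> s \<and> \<tau> s < t3 \<and>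
      (\<forall>t. 0 < t \<and> t < \<tau> s \<longrightarrow> 0 < w s t) \<and> (\<forall>t. \<tau> s < t \<and> t \<le> t3 \<longrightarrow> w s t < 0) \<and>
      R0 (flow (s *\<^sub>R u) (\<tau> s)) = flow (s *\<^sub>R u) (\<tau> s) \<and> flow (s *\<^sub>R u) (\<tau> s) \<bullet> u < 0"
    by metis
  have \<tau>_pos: "0 < \<tau> s" if "0 < s" "s < \<delta>" for s
  proof -
    have "0 < 3 * pi / (4 * \<alpha>)" using \<alpha>_pos by simp
    then show ?thesis using \<tau>[OF that] by simp
  qed
  have start: "R0 (s *\<^sub>R u) = s *\<^sub>R u" for s by (simp add: R0_scaleR u)
  have reduce: "\<exists>t'. \<bar>t'\<bar> \<le> \<tau> s \<and> flow (s *\<^sub>R u) t = flow (s *\<^sub>R u) t'" if "0 < s" "s < \<delta>" for s t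
    using flow_reduce_time[OF start, of s "\<tau> s" t] \<tau>[OF that] \<tau>_pos[OF that] by metis
  have orbit_norm: "norm (flow (s *\<^sub>R u) t) \<le> s * E" if s: "0 < s" "s < \<delta>" for s t
  proof -
    obtain t' where t': "\<bar>t'\<bar> \<le> \<tau> s" "flow (s *\<^sub>R u) t = flow (s *\<^sub>R u) t'" using reduce[OF s] by blast
    have "norm (flow (s *\<^sub>R u) t') \<le> s * exp ((2 * L + 1) * \<bar>t'\<bar>)"
      using norm_flow_le[of "s *\<^sub>R u" t'] u(2) s by simp
    also have "\<dots> \<le> s * E"
      using t'(1) \<tau>[OF s] s L_pos unfolding E_def by (intro mult_left_mono) auto
    finally show ?thesis using t'(2) by simp
  qed
  have fixed_points: "flow (s *\<^sub>R u) t = s *\<^sub>R u"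
    if s: "0 < s" "s < \<delta>" and fp: "R0 (flow (s *\<^sub>R u) t) = flow (s *\<^sub>R u) t" and "0 \<le> flow (s *\<^sub>R u) t \<bullet> u" for s t
  proof -
    obtain t' where t': "\<bar>t'\<bar> \<le> \<tau> s" "flow (s *\<^sub>R u) t = flow (s *\<^sub>R u) t'" using reduce[OF s] by blast
    have "flow (s *\<^sub>R u) t' = R0 (flow (s *\<^sub>R u) (- t'))"
      using flow_R0[of "s *\<^sub>R u" t'] unfolding start .
    then have "flow (s *\<^sub>R u) \<bar>t'\<bar> = flow (s *\<^sub>R u) t"
      using fp t'(2) by (metis R0_involution abs_if)
    moreover have "flow (s *\<^sub>R u) t \<bullet> A u = 0"
      using fp[unfolded R0_fixed_iff] A_fixed[OF u(1)] unfolding inner_vec_4 by simp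
    ultimately have abs_t': "flow (s *\<^sub>R u) \<bar>t'\<bar> = flow (s *\<^sub>R u) t" "w s \<bar>t'\<bar> = 0"
      unfolding w_def by simp_all
    have "\<not> (0 < \<bar>t'\<bar> \<and> \<bar>t'\<bar> < \<tau> s)" using \<tau>[OF s] abs_t'(2) by (metis less_irrefl)
    moreover have "\<bar>t'\<bar> \<noteq> \<tau> s"
    proof
      assume "\<bar>t'\<bar> = \<tau> s"
      then have "flow (s *\<^sub>R u) t = flow (s *\<^sub>R u) (\<tau> s)" using abs_t'(1) by simp
      then show False using \<tau>[OF s] that(4) by auto
    qed
    ultimately have "\<bar>t'\<bar> = 0" using t'(1) by linarith
    then show ?thesis using t'(2) by simp
  qed
  have \<tau>_cont: "continuous_on {0<..<\<delta>} \<tau>"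
  proof (rule continuous_onI)
    fix s0 e :: real assume s0: "s0 \<in> {0<..<\<delta>}" and e: "0 < e"
    then have s0': "0 < s0" "s0 < \<delta>" by auto
    \<comment> \<open>Opposite signs of \<open>w\<close> at fixed times \<open>a < b\<close> around \<open>\<tau> s0\<close> persist for \<open>s\<close> near \<open>s0\<close> and trap
        \<open>\<tau> s\<close> between them.\<close>
    define a b where "a = max (\<tau> s0 - e / 2) (\<tau> s0 / 2)" and "b = min (\<tau> s0 + e / 2) ((\<tau> s0 + t3) / 2)"
    have ab: "0 < a" "a < \<tau> s0" "\<tau> s0 < b" "b < t3" "\<tau> s0 - e < a" "b < \<tau> s0 + e"
      using \<tau>_pos[OF s0'] \<tau>[OF s0'] e by (auto simp: a_def b_def max_def min_def)
    have "isCont (\<lambda>s. w s t) s0" for t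
      unfolding w_def
      by (intro continuous_on_interior[of UNIV] continuous_intros) auto
    then have lim: "((\<lambda>s. w s t) \<longlongrightarrow> w s0 t) (nhds s0)" for t
      unfolding isCont_def by (rule tendsto_at_iff_tendsto_nhds[THEN iffD1])
    have "0 < w s0 a" "w s0 b < 0" using \<tau>[OF s0'] ab by auto
    then have "\<forall>\<^sub>F s in nhds s0. 0 < w s a \<and> w s b < 0 \<and> s \<in> {0<..<\<delta>}"
      by (intro eventually_conj order_tendstoD[OF lim] eventually_nhds_in_open s0 open_greaterThanLessThan)
    then obtain d where d: "0 < d" "\<And>s. dist s s0 < d \<Longrightarrow> 0 < w s a \<and> w s b < 0 \<and> s \<in> {0<..<\<delta>}"
      unfolding eventually_nhds_metric by blast
    have "dist (\<tau> s) (\<tau> s0) \<le> e" if "dist s s0 < d" for s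
    proof -
      have s: "0 < s" "s < \<delta>" and sign: "0 < w s a" "w s b < 0" using d(2)[OF that] by auto
      have "a \<le> \<tau> s"
        using \<tau>[OF s] sign(1) ab by (meson less_trans less_imp_le not_le order_less_asym)
      moreover have "\<tau> s \<le> b"
        using \<tau>[OF s] sign(2) ab by (meson less_trans not_le order_less_asym)
      ultimately show ?thesis using ab by (simp add: dist_real_def abs_le_iff)
    qed
    then show "\<exists>d>0. \<forall>s\<in>{0<..<\<delta>}. dist s s0 < d \<longrightarrow> dist (\<tau> s) (\<tau> s0) \<le> e"
      using d(1) by blast
  qed
  have "symmetric_periodic_family F \<delta> (\<lambda>s. flow (s *\<^sub>R u))"
    unfolding symmetric_periodic_family_def
  proof (intro conjI ballI)
    show "0 < \<delta>" by fact
    show "\<exists>T. continuous_on {0<..<\<delta>} T \<and> (\<forall>s\<in>{0<..<\<delta>}. periodic_solution F (T s) (flow (s *\<^sub>R u)))"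
    proof (intro exI[of _ "\<lambda>s. 2 * \<tau> s"] conjI ballI)
      show "continuous_on {0<..<\<delta>} (\<lambda>s. 2 * \<tau> s)" by (intro continuous_intros \<tau>_cont)
      fix s assume "s \<in> {0<..<\<delta>}"
      then have s: "0 < s" "s < \<delta>" by auto
      have "flow (s *\<^sub>R u) (\<tau> s) \<bullet> u < 0" using \<tau>[OF s] by blast
      moreover have "0 < (s *\<^sub>R u) \<bullet> u" using s u(2) by (simp add: norm_eq_1)
      ultimately have "flow (s *\<^sub>R u) (\<tau> s) \<noteq> flow (s *\<^sub>R u) 0" by auto
      then show "periodic_solution F (2 * \<tau> s) (flow (s *\<^sub>R u))"
        unfolding periodic_solution_def
        using \<tau>_pos[OF s] \<tau>[OF s] flow_deriv flow_periodic[OF start] by auto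
    qed
    show "symmetric_orbit (flow (s *\<^sub>R u))" for s
    proof -
      have "R0 (flow (s *\<^sub>R u) t) = flow (s *\<^sub>R u) (- t)" for t
        using flow_R0[of "s *\<^sub>R u" "- t"] unfolding start minus_minus by (rule sym)
      then have "R0 ` range (flow (s *\<^sub>R u)) = range (\<lambda>t. flow (s *\<^sub>R u) (- t))"
        by (auto simp: image_image)
      also have "\<dots> = range (flow (s *\<^sub>R u))"
        by (auto simp: image_iff) (metis minus_minus)
      finally show ?thesis by (simp add: symmetric_orbit_def)
    qed
    show "continuous_on ({0<..<\<delta>} \<times> UNIV) (\<lambda>(s, t). flow (s *\<^sub>R u) t)"
      unfolding case_prod_beta by (intro continuous_intros)
    show "inj_on (\<lambda>s. range (flow (s *\<^sub>R u))) {0<..<\<delta>}"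
    proof (rule inj_onI)
      fix s s' assume s: "s \<in> {0<..<\<delta>}" "s' \<in> {0<..<\<delta>}"
        and eq: "range (flow (s *\<^sub>R u)) = range (flow (s' *\<^sub>R u))"
      have "s *\<^sub>R u \<in> range (flow (s *\<^sub>R u))" by (metis flow_0 rangeI)
      then obtain t where t: "flow (s' *\<^sub>R u) t = s *\<^sub>R u" unfolding eq by auto
      then have "s *\<^sub>R u = s' *\<^sub>R u"
        using fixed_points[of s' t] s start[of s] by simp
      then show "s = s'" using u(2) by auto
    qed
    show "\<forall>e>0. \<forall>\<^sub>F s in at_right 0. \<forall>t. norm (flow (s *\<^sub>R u) t) < e"
    proof (intro allI impI)
      fix e :: real assume e: "0 < e"
      have "0 < E" by (simp add: E_def)
      have "\<forall>\<^sub>F s in at_right 0. s \<in> {0<..<min \<delta> (e / E)}"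
        by (rule eventually_at_right_real) (use \<delta> e \<open>0 < E\<close> in simp)
      then show "\<forall>\<^sub>F s in at_right 0. \<forall>t. norm (flow (s *\<^sub>R u) t) < e"
      proof (rule eventually_mono)
        fix s assume s: "s \<in> {0<..<min \<delta> (e / E)}"
        then have "s * E < e" using \<open>0 < E\<close> by (simp add: field_simps)
        then show "\<forall>t. norm (flow (s *\<^sub>R u) t) < e"
          using orbit_norm[of s] s by (force intro: le_less_trans)
      qed
    qed
  qed
  moreover have "norm (flow (s *\<^sub>R u) t) < r" if "s \<in> {0<..<\<delta>}" for s t
    using orbit_norm[of s t] half that by force
  ultimately show ?thesis using fixed_points by (intro exI[of _ \<delta>]) auto
qed

end

section \<open>Reversible Hamiltonian germs with a centre\<close>

lemma bounded_linear_symplectic_form_left: "bounded_linear (\<lambda>x. symplectic_form x v)"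
proof -
  have "(\<lambda>x. symplectic_form x v) = (\<lambda>x. x \<bullet> vector [v $ 2, - v $ 1, v $ 4, - v $ 3])"
    by (simp add: symplectic_form_def inner_vec_4 fun_eq_iff)
  then show ?thesis by (simp add: bounded_linear_inner_left)
qed

lemma has_derivative_ham_vf:
  assumes "H differentiable (at x)"
  shows "(H has_derivative symplectic_form (ham_vf H x)) (at x)"
  using has_derivative_sum_partial[OF assms]
  by (rule has_derivative_eq_rhs) (simp add: fun_eq_iff sum_4 symplectic_form_def ham_vf_def algebra_simps)

lemma Omega0_local_form:
  assumes "X \<in> Omega0"
  obtains H r L where "0 < r" "0 < L" "X 0 = 0" "H 0 = 0"
    "\<And>x y. x \<in> cball 0 r \<Longrightarrow> y \<in> cball 0 r \<Longrightarrow> norm (X x - X y) \<le> L * norm (x - y)"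
    "\<And>x. x \<in> cball 0 r \<Longrightarrow> X (R0 x) = - R0 (X x)"
    "\<And>x. x \<in> cball 0 r \<Longrightarrow> (H has_derivative symplectic_form (X x)) (at x)"
proof -
  obtain H where H: "smooth_germ H" "H 0 = 0" "same_germ X (ham_vf H)" and X0: "X 0 = 0" and rev: "reversible X"
    using assms unfolding Omega0_def is_hamiltonian_of_def by blast
  obtain W where W: "open W" "0 \<in> W" "smooth_on W H" using H(1) unfolding smooth_germ_def by blast
  obtain V where V: "open V" "0 \<in> V" "smooth_on V X"
    using smooth_germ_Omega0[OF assms] unfolding smooth_germ_def by blast
  obtain r1 L where r1: "0 < r1" and L: "0 < L"
    "\<forall>x\<in>cball 0 r1. \<forall>y\<in>cball 0 r1. norm (X x - X y) \<le> L * norm (x - y)"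
    using smooth_on_locally_lipschitz[OF V] by blast
  have "\<forall>\<^sub>F x in nhds 0. x \<in> W \<and> X x = ham_vf H x \<and> X (R0 x) = - R0 (X x)"
    using eventually_nhds_in_open[OF W(1,2)] H(3) rev
    unfolding same_germ_def reversible_def by (simp add: eventually_conj_iff)
  then obtain d where d: "0 < d" "\<And>x. dist x 0 < d \<Longrightarrow> x \<in> W \<and> X x = ham_vf H x \<and> X (R0 x) = - R0 (X x)"
    unfolding eventually_nhds_metric by blast
  define r where "r = min r1 (d / 2)"
  have r: "0 < r" "cball 0 r \<subseteq> cball (0::real^4) r1" "\<And>x. x \<in> cball 0 r \<Longrightarrow> dist x (0::real^4) < d"
    using r1 d(1) by (auto simp: r_def)
  show ?thesis
  proof (rule that[where H = H and r = r and L = L])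
    show "norm (X x - X y) \<le> L * norm (x - y)" if "x \<in> cball 0 r" "y \<in> cball 0 r" for x y
      using L(2) r(2) that by blast
    fix x :: "real^4" assume "x \<in> cball 0 r"
    note x = d(2)[OF r(3)[OF this]]
    show "X (R0 x) = - R0 (X x)" using x by blast
    have "H differentiable (at x)" using smooth_onD[OF W(3), of x "[]"] x by simp
    then show "(H has_derivative symplectic_form (X x)) (at x)"
      using has_derivative_ham_vf x by metis
  qed (fact r(1) L(1) X0 H(2))+
qed

text \<open>
  The determinant of the block \<open>B\<close> of the linear part at \<open>0\<close> that maps the \<open>(x\<^sub>2, y\<^sub>2)\<close>-plane to
  the \<open>(x\<^sub>1, y\<^sub>1)\<close>-plane. For a reversible Hamiltonian field the characteristic
  polynomial of the linear part is \<open>(\<lambda>\<^sup>2 + det B)\<^sup>2\<close>.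
\<close>

definition transfer_det :: "(real ^ 4 \<Rightarrow> real ^ 4) \<Rightarrow> real" where
  "transfer_det X = partial 3 X 0 $ 1 * partial 4 X 0 $ 2 - partial 4 X 0 $ 1 * partial 3 X 0 $ 2"

text \<open>
  Reversibility annihilates the diagonal blocks of \<open>A\<close>, and the symmetry of \<open>\<omega> (A a, b)\<close> makes
  the lower left block minus the adjugate of the upper right one.
\<close>

lemma reversible_hamiltonian_square:
  fixes A :: "real ^ 4 \<Rightarrow> real ^ 4"
  assumes A: "linear A" and rev: "\<And>v. A (R0 v) = - R0 (A v)"
    and sym: "\<And>a b. symplectic_form (A a) b = symplectic_form (A b) a"
  shows "A (A v) = - (A (axis 3 1) $ 1 * A (axis 4 1) $ 2 - A (axis 4 1) $ 1 * A (axis 3 1) $ 2) *\<^sub>R v"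
proof -
  have A_eq: "A v = v $ 1 *\<^sub>R A (axis 1 1) + v $ 2 *\<^sub>R A (axis 2 1) + v $ 3 *\<^sub>R A (axis 3 1) + v $ 4 *\<^sub>R A (axis 4 1)" for v
    using linear_sum[OF A, of "\<lambda>i. v $ i *\<^sub>R axis i 1" UNIV] basis_expansion[of v]
    by (simp add: sum_4 linear_cmul[OF A] scalar_mult_eq_scaleR)
  have R0_axis: "R0 (axis 1 1) = axis 1 1" "R0 (axis 2 1) = axis 2 1"
    "R0 (axis 3 1) = - axis 3 1" "R0 (axis 4 1) = - axis 4 1"
    by (simp_all add: vec_eq_iff_4 axis_def)
  have "A (axis 1 1) $ 1 = 0" "A (axis 1 1) $ 2 = 0" "A (axis 2 1) $ 1 = 0" "A (axis 2 1) $ 2 = 0"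
    "A (axis 3 1) $ 3 = 0" "A (axis 3 1) $ 4 = 0" "A (axis 4 1) $ 3 = 0" "A (axis 4 1) $ 4 = 0"
    using rev[of "axis 1 1"] rev[of "axis 2 1"] rev[of "axis 3 1"] rev[of "axis 4 1"]
    by (simp_all add: R0_axis vec_eq_iff_4 linear_neg[OF A])
  moreover have "A (axis 1 1) $ 4 = A (axis 3 1) $ 2" "A (axis 1 1) $ 3 = - A (axis 4 1) $ 2"
    "A (axis 2 1) $ 4 = - A (axis 3 1) $ 1" "A (axis 2 1) $ 3 = A (axis 4 1) $ 1"
    using sym[of "axis 1 1" "axis 3 1"] sym[of "axis 1 1" "axis 4 1"]
      sym[of "axis 2 1" "axis 3 1"] sym[of "axis 2 1" "axis 4 1"]
    by (simp_all add: symplectic_form_def axis_def)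
  ultimately show ?thesis
    unfolding A_eq[of "A v"] unfolding A_eq[of v] by (simp add: vec_eq_iff_4 algebra_simps)
qed

text \<open>
  \<open>R0\<close> is an isometry that maps the ball to itself. By this equivariance, composing a field with the
  projection preserves reversibility.
\<close>

lemma closest_point_cball_R0: "closest_point (cball 0 r) (R0 x) = R0 (closest_point (cball 0 r) x)" if "0 \<le> r"
proof (rule closest_point_unique[symmetric])
  have dist_R0: "dist (R0 a) (R0 b) = dist a b" for a b
  proof -
    have "R0 a - R0 b = R0 (a - b)" by (simp add: vec_eq_iff_4)
    then show ?thesis by (simp add: dist_norm)
  qed
  have ne: "cball (0::real^4) r \<noteq> {}" using that by simp
  show "R0 (closest_point (cball 0 r) x) \<in> cball 0 r"
    using closest_point_in_set[OF closed_cball ne, of x] by simp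
  show "\<forall>z\<in>cball 0 r. dist (R0 x) (R0 (closest_point (cball 0 r) x)) \<le> dist (R0 x) z"
  proof
    fix z :: "real^4" assume "z \<in> cball 0 r"
    then have "dist x (closest_point (cball 0 r) x) \<le> dist x (R0 z)"
      by (intro closest_point_le[OF closed_cball]) simp
    also have "\<dots> = dist (R0 x) z" using dist_R0[of x "R0 z"] by simp
    finally show "dist (R0 x) (R0 (closest_point (cball 0 r) x)) \<le> dist (R0 x) z" by (simp add: dist_R0)
  qed
qed auto

lemma symmetric_periodic_family_cong:
  assumes "symmetric_periodic_family F \<delta> \<gamma>" "\<And>s t. s \<in> {0<..<\<delta>} \<Longrightarrow> F (\<gamma> s t) = X (\<gamma> s t)"
  shows "symmetric_periodic_family X \<delta> \<gamma>"
  using assms unfolding symmetric_periodic_family_def periodic_solution_def by simp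

lemma two_families_of_transfer_det_pos:
  assumes X: "X \<in> Omega0" and det: "0 < transfer_det X"
  shows "has_two_symmetric_periodic_families X"
proof -
  obtain H r L where r: "0 < r" and L: "0 < L" and X0: "X 0 = 0" and H0: "H 0 = 0"
    and lip: "\<And>x y. x \<in> cball 0 r \<Longrightarrow> y \<in> cball 0 r \<Longrightarrow> norm (X x - X y) \<le> L * norm (x - y)"
    and rev: "\<And>x. x \<in> cball 0 r \<Longrightarrow> X (R0 x) = - R0 (X x)"
    and dH: "\<And>x. x \<in> cball 0 r \<Longrightarrow> (H has_derivative symplectic_form (X x)) (at x)"
    using Omega0_local_form[OF X] by metis
  obtain V where V: "open V" "0 \<in> V" "smooth_on V X"
    using smooth_germ_Omega0[OF X] unfolding smooth_germ_def by blast
  obtain A where A: "(X has_derivative A) (at 0)"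
    using smooth_onD[OF V(3,2), of "[]"] unfolding differentiable_def by auto
  have A_axis: "A (axis i 1) = partial i X 0" for i
    by (rule partial_eq_derivative[OF A, symmetric])
  have A_R0: "A (R0 v) = - R0 (A v)" for v
  proof -
    have "((\<lambda>x. X (R0 x)) has_derivative (\<lambda>v. A (R0 v))) (at 0)"
      using has_derivative_compose[OF bounded_linear_imp_has_derivative[OF bounded_linear_R0, of "at 0"]] A by simp
    moreover have "((\<lambda>x. X (R0 x)) has_derivative (\<lambda>v. - R0 (A v))) (at 0)"
    proof (rule has_derivative_transform_within_open)
      show "((\<lambda>x. - R0 (X x)) has_derivative (\<lambda>v. - R0 (A v))) (at 0)"
        by (intro has_derivative_minus bounded_linear.has_derivative[OF bounded_linear_R0 A])
    qed (use r rev in \<open>auto intro: open_ball[of 0 r]\<close>)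
    ultimately show ?thesis by (metis has_derivative_unique)
  qed
  have "symplectic_form (A a) b = symplectic_form (A b) a" for a b
    by (rule second_derivative_symmetric[where H = H and r = r and G = "\<lambda>x. symplectic_form (X x)"])
      (use r dH in \<open>auto intro: bounded_linear.has_derivative[OF bounded_linear_symplectic_form_left A]\<close>)
  from reversible_hamiltonian_square[OF has_derivative_linear[OF A] A_R0 this]
  have A_sq: "A (A v) = - (sqrt (transfer_det X))\<^sup>2 *\<^sub>R v" for v
    using det by (simp add: A_axis transfer_det_def)
  define P :: "real^4 \<Rightarrow> real^4" where "P = closest_point (cball 0 r)"
  define F where "F x = X (P x)" for x
  have P_in: "P x \<in> cball 0 r" for x
    unfolding P_def by (rule closest_point_in_set) (use r in auto)
  have P_id: "P x = x" if "x \<in> cball 0 r" for x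
    unfolding P_def by (rule closest_point_self[OF that])
  interpret reversible_center F A H L r "sqrt (transfer_det X)"
  proof
    show "norm (F x - F y) \<le> L * norm (x - y)" for x y
    proof -
      have "norm (F x - F y) \<le> L * norm (P x - P y)" unfolding F_def by (rule lip[OF P_in P_in])
      also have "\<dots> \<le> L * norm (x - y)"
        using closest_point_lipschitz[of "cball (0::real^4) r" x y] r L by (simp add: P_def dist_norm)
      finally show ?thesis .
    qed
    show "F 0 = 0" using r X0 by (simp add: F_def P_id)
    show "F (R0 x) = - R0 (F x)" for x
      using closest_point_cball_R0[of r x] r rev[OF P_in[of x]] by (simp add: F_def P_def)
    show "(F has_derivative A) (at 0)"
      by (rule has_derivative_transform_within_open[OF A open_ball[of 0 r]]) (use r in \<open>auto simp: F_def P_id\<close>)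
    show "(H has_derivative symplectic_form (F x)) (at x)" if "x \<in> ball 0 r" for x
      using dH[of x] that by (simp add: F_def P_id)
  qed (use L H0 r det A_R0 in \<open>simp_all add: A_sq\<close>)
  define u1 u2 :: "real^4" where "u1 = axis 1 1" and "u2 = axis 2 1"
  have u: "R0 u1 = u1" "norm u1 = 1" "R0 u2 = u2" "norm u2 = 1"
    by (auto simp: u1_def u2_def vec_eq_iff_4 axis_def[of 1] axis_def[of 2] norm_eq_sqrt_inner inner_vec_4)
  obtain \<delta>1 where f1: "symmetric_periodic_family F \<delta>1 (\<lambda>s. flow (s *\<^sub>R u1))"
    and n1: "\<And>s t. s \<in> {0<..<\<delta>1} \<Longrightarrow> norm (flow (s *\<^sub>R u1) t) < r"
    using symmetric_periodic_family_flow[OF u(1,2)] by blast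
  obtain \<delta>2 where f2: "symmetric_periodic_family F \<delta>2 (\<lambda>s. flow (s *\<^sub>R u2))"
    and n2: "\<And>s t. s \<in> {0<..<\<delta>2} \<Longrightarrow> norm (flow (s *\<^sub>R u2) t) < r"
    and fp: "\<And>s t. s \<in> {0<..<\<delta>2} \<Longrightarrow> R0 (flow (s *\<^sub>R u2) t) = flow (s *\<^sub>R u2) t \<Longrightarrow>
      0 \<le> flow (s *\<^sub>R u2) t \<bullet> u2 \<Longrightarrow> flow (s *\<^sub>R u2) t = s *\<^sub>R u2"
    using symmetric_periodic_family_flow[OF u(3,4)] by blast
  have "symmetric_periodic_family X \<delta>1 (\<lambda>s. flow (s *\<^sub>R u1))"
    by (rule symmetric_periodic_family_cong[OF f1]) (use n1 in \<open>simp add: F_def P_id less_imp_le\<close>)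
  moreover have "symmetric_periodic_family X \<delta>2 (\<lambda>s. flow (s *\<^sub>R u2))"
    by (rule symmetric_periodic_family_cong[OF f2]) (use n2 in \<open>simp add: F_def P_id less_imp_le\<close>)
  moreover have "range (flow (s *\<^sub>R u1)) \<noteq> range (flow (s' *\<^sub>R u2))"
    if s: "s \<in> {0<..<\<delta>1}" "s' \<in> {0<..<\<delta>2}" for s s'
  proof
    assume eq: "range (flow (s *\<^sub>R u1)) = range (flow (s' *\<^sub>R u2))"
    have "s *\<^sub>R u1 \<in> range (flow (s *\<^sub>R u1))" by (metis flow_0 rangeI)
    then obtain t where t: "flow (s' *\<^sub>R u2) t = s *\<^sub>R u1" unfolding eq by auto
    have "u1 \<bullet> u2 = 0" by (simp add: u1_def u2_def inner_axis_axis)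
    then have "s *\<^sub>R u1 = s' *\<^sub>R u2"
      using fp[OF s(2), of t] unfolding t by (simp add: R0_scaleR u)
    then have "(s *\<^sub>R u1) $ 1 = (s' *\<^sub>R u2) $ 1" by simp
    then show False using s by (simp add: u1_def u2_def axis_def)
  qed
  ultimately show ?thesis
    unfolding has_two_symmetric_periodic_families_def by blast
qed

section \<open>The open set and a field in it\<close>

lemma partial_same_germ:
  assumes "same_germ f g"
  shows "partial i f 0 = partial i g 0"
proof -
  obtain W where W: "open W" "0 \<in> W" "\<And>x. x \<in> W \<Longrightarrow> f x = g x"
    using assms unfolding same_germ_def eventually_nhds by blast
  have "iter_partial [i] f 0 = iter_partial [i] g 0"
    by (rule iter_partial_cong_open[OF W(1) _ W(2)]) (rule W(3))
  then show ?thesis by simp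
qed

lemma Cinf_open_transfer_det_pos: "Cinf_open {X. smooth_germ X \<and> 0 < transfer_det X}"
proof (rule Cinf_openI)
  show "g \<in> {X. smooth_germ X \<and> 0 < transfer_det X}"
    if "f \<in> {X. smooth_germ X \<and> 0 < transfer_det X}" "same_germ f g" for f g
    using that smooth_germ_same_germ partial_same_germ[OF that(2)] by (auto simp: transfer_det_def)
  fix V :: "(real^4) set" and f :: "real^4 \<Rightarrow> real^4"
  assume V: "open V" "0 \<in> V" and f: "f \<in> {X. smooth_germ X \<and> 0 < transfer_det X}"
  define D where "D = {p :: (real^4) \<times> (real^4). 0 < fst p $ 1 * snd p $ 2 - snd p $ 1 * fst p $ 2}"
  have "open D"
    unfolding D_def by (intro open_Collect_less continuous_intros)
  moreover have "(partial 3 f 0, partial 4 f 0) \<in> D" using f by (simp add: D_def transfer_det_def)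
  ultimately obtain e where e: "0 < e" "\<And>p. dist p (partial 3 f 0, partial 4 f 0) < e \<Longrightarrow> p \<in> D"
    unfolding open_dist by metis
  have "g \<in> {X. smooth_germ X \<and> 0 < transfer_det X}"
    if g: "smooth_on V g" "Ck_close {0} 1 (e / 2) f g" for g
  proof -
    have close: "norm (partial i g 0 - partial i f 0) < e / 2" for i
      using g(2)[unfolded Ck_close_def, rule_format, of "[i]" 0] by simp
    have "dist (partial 3 g 0, partial 4 g 0) (partial 3 f 0, partial 4 f 0)
        \<le> norm (partial 3 g 0 - partial 3 f 0) + norm (partial 4 g 0 - partial 4 f 0)"
      by (simp add: dist_Pair_Pair sqrt_sum_squares_le_sum flip: dist_norm)
    also have "\<dots> < e" using close[of 3] close[of 4] by simp
    finally have "(partial 3 g 0, partial 4 g 0) \<in> D" by (rule e(2))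
    then show ?thesis using g(1) V by (auto simp: D_def transfer_det_def smooth_germ_def)
  qed
  then show "\<exists>K k e. compact K \<and> K \<subseteq> V \<and> e > 0 \<and>
      (\<forall>g. smooth_on V g \<and> Ck_close K k e f g \<longrightarrow> g \<in> {X. smooth_germ X \<and> 0 < transfer_det X})"
    using V e(1) by (intro exI[of _ "{0}"] exI[of _ 1] exI[of _ "e / 2"]) simp
qed auto

text \<open>
  The quadratic Hamiltonian of two oscillators in \<open>1 : -1\<close> resonance, in coordinates adapted to \<open>R0\<close>.
  Its field is linear, hence analytic, and equals its own Birkhoff normal form, so it shows
  both open sets to be nonempty.
\<close>

definition model_ham :: "real ^ 4 \<Rightarrow> real" where
  "model_ham x = x $ 2 * x $ 3 - x $ 1 * x $ 4"

definition model_field :: "real ^ 4 \<Rightarrow> real ^ 4" where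
  "model_field x = vector [x $ 3, x $ 4, - x $ 1, - x $ 2]"

lemma model_field_simps [simp]:
  "model_field x $ 1 = x $ 3" "model_field x $ 2 = x $ 4"
  "model_field x $ 3 = - x $ 1" "model_field x $ 4 = - x $ 2"
  by (simp_all add: model_field_def)

lemma has_derivative_model_ham: "(model_ham has_derivative symplectic_form (model_field x)) (at x)"
proof -
  have nth: "((\<lambda>x. x $ k) has_derivative (\<lambda>v. v $ k)) (at x)" for k :: 4
    by (rule bounded_linear_imp_has_derivative[OF bounded_linear_vec_nth])
  show ?thesis
    unfolding model_ham_def
    by (rule has_derivative_eq_rhs[OF has_derivative_diff[OF has_derivative_mult[OF nth nth] has_derivative_mult[OF nth nth]]])
      (simp add: fun_eq_iff symplectic_form_def algebra_simps)
qed

lemma partial_model_ham: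
  "partial 1 model_ham = (\<lambda>x. - x $ 4)" "partial 2 model_ham = (\<lambda>x. x $ 3)"
  "partial 3 model_ham = (\<lambda>x. x $ 2)" "partial 4 model_ham = (\<lambda>x. - x $ 1)"
  by (simp_all add: fun_eq_iff partial_eq_derivative[OF has_derivative_model_ham] symplectic_form_def axis_def)

lemma ham_vf_model_ham: "ham_vf model_ham = model_field"
  by (simp add: fun_eq_iff ham_vf_def vec_eq_iff_4 partial_model_ham)

lemma partial_bounded_linear:
  assumes "bounded_linear f"
  shows "partial i f = (\<lambda>x. f (axis i 1))"
  by (rule ext) (rule partial_eq_derivative[OF bounded_linear_imp_has_derivative[OF assms]])

lemma partial_const: "partial i (\<lambda>x. c) = (\<lambda>x. 0)"
  by (rule ext) (rule partial_eq_derivative[OF has_derivative_const])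

lemma iter_partial_const: "is \<noteq> [] \<Longrightarrow> iter_partial is (\<lambda>x. c) = (\<lambda>x. 0)"
proof (induction "is")
  case (Cons i js)
  then show ?case
    by (cases "js = []") (simp_all add: partial_const)
qed simp

lemma smooth_on_const: "smooth_on V (\<lambda>x. c)"
  unfolding smooth_on_def
proof (intro allI ballI)
  show "iter_partial is (\<lambda>x. c) differentiable (at x)" for "is" x
    by (cases "is = []") (simp_all add: iter_partial_const)
qed

text \<open>
  Splitting off the innermost instead of the outermost partial derivative reduces smoothness of a
  polynomial to that of its derivatives.
\<close>

lemma smooth_on_iff_partial:
  "smooth_on V f \<longleftrightarrow> (\<forall>x\<in>V. f differentiable (at x)) \<and> (\<forall>i. smooth_on V (partial i f))"
proof -
  have "(\<forall>is. P is) \<longleftrightarrow> P [] \<and> (\<forall>i is. P (is @ [i]))" for P :: "'a list \<Rightarrow> bool"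
    by (metis rev_exhaust)
  from this[of "\<lambda>is. \<forall>x\<in>V. iter_partial is f differentiable (at x)"] show ?thesis
    unfolding smooth_on_def iter_partial_partial by auto
qed

lemma smooth_on_bounded_linear:
  fixes f :: "real ^ 'n::finite \<Rightarrow> 'b::real_normed_vector"
  assumes "bounded_linear f"
  shows "smooth_on V f"
  unfolding smooth_on_iff_partial[of V f] partial_bounded_linear[OF assms]
  using bounded_linear_imp_differentiable[OF assms] smooth_on_const by blast

lemma smooth_on_model_ham: "smooth_on V model_ham"
proof -
  have "\<forall>i. smooth_on V (partial i model_ham)"
    unfolding forall_4 partial_model_ham
    by (intro conjI smooth_on_bounded_linear bounded_linear_minus bounded_linear_vec_nth)
  then show ?thesis
    using has_derivative_model_ham by (subst smooth_on_iff_partial) (auto simp: differentiable_def)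
qed

lemma is_hamiltonian_of_model: "is_hamiltonian_of model_ham model_field"
  unfolding is_hamiltonian_of_def ham_vf_model_ham smooth_germ_def same_germ_def
  using smooth_on_model_ham open_UNIV by (auto simp: model_ham_def)

lemma model_field_Omega0: "model_field \<in> Omega0"
  unfolding Omega0_def reversible_def
  using is_hamiltonian_of_model by (auto simp: vec_eq_iff_4)

lemma quadratic_part_model_ham: "quadratic_part model_ham = model_ham"
proof -
  have lin: "bounded_linear (\<lambda>x :: real^4. x $ k)" "bounded_linear (\<lambda>x :: real^4. - x $ k)" for k
    by (intro bounded_linear_vec_nth bounded_linear_minus)+
  show ?thesis
    by (simp add: fun_eq_iff quadratic_part_def sum_4 partial_model_ham partial_bounded_linear[OF lin(1)]
        partial_bounded_linear[OF lin(2)] axis_def model_ham_def)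
qed

lemma model_field_Omega0_B: "model_field \<in> Omega0_B"
proof -
  have "poisson (quadratic_part model_ham) model_ham x = 0" for x
    by (simp add: poisson_def quadratic_part_model_ham symplectic_form_def)
  then show ?thesis
    unfolding Omega0_B_def birkhoff_def using model_field_Omega0 is_hamiltonian_of_model by auto
qed

lemma analytic_germ_linear:
  fixes f :: "real ^ 'n::finite \<Rightarrow> 'b::real_normed_vector"
  assumes "linear f"
  shows "analytic_germ f"
proof -
  define E :: "'n \<Rightarrow> nat ^ 'n" where "E i = axis i 1" for i
  have inj: "inj E" by (auto simp: inj_def E_def axis_eq_axis)
  define c where "c a = (if a \<in> range E then f (axis (inv E a) 1) else 0)" for a
  have "((\<lambda>a. (\<Prod>i\<in>UNIV. (x $ i) ^ (a $ i)) *\<^sub>R c a) has_sum f x) UNIV" for x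
  proof (rule has_sum_finite_neutralI[of "range E"])
    have monomial: "(\<Prod>i\<in>UNIV. (x $ i) ^ (E j $ i)) = x $ j" for j
    proof -
      have "(\<Prod>i\<in>UNIV. (x $ i) ^ (E j $ i)) = (\<Prod>i\<in>UNIV. if i = j then x $ i else 1)"
        by (rule prod.cong) (auto simp: E_def axis_def)
      then show ?thesis by simp
    qed
    have "f x = (\<Sum>j\<in>UNIV. x $ j *\<^sub>R f (axis j 1))"
      using linear_sum[OF assms, of "\<lambda>i. x $ i *\<^sub>R axis i 1" UNIV] basis_expansion[of x]
      by (simp add: linear_cmul[OF assms] scalar_mult_eq_scaleR)
    also have "\<dots> = (\<Sum>a\<in>range E. (\<Prod>i\<in>UNIV. (x $ i) ^ (a $ i)) *\<^sub>R c a)"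
      by (subst sum.reindex[OF inj]) (simp add: monomial c_def inv_f_f[OF inj])
    finally show "f x = (\<Sum>a\<in>range E. (\<Prod>i\<in>UNIV. (x $ i) ^ (a $ i)) *\<^sub>R c a)" .
  qed (auto simp: c_def)
  then show ?thesis unfolding analytic_germ_def by (intro exI[of _ "1::real"] conjI exI[of _ c]) auto
qed

lemma model_field_Omega0_omega: "model_field \<in> Omega0_omega"
proof -
  have "linear model_field" by (rule linearI) (simp_all add: vec_eq_iff_4)
  then show ?thesis unfolding Omega0_omega_def using model_field_Omega0 analytic_germ_linear by auto
qed

lemma transfer_det_model_field: "transfer_det model_field = 1"
proof -
  have "bounded_linear model_field"
    by (intro linear_conv_bounded_linear[THEN iffD1] linearI) (simp_all add: vec_eq_iff_4)
  then show ?thesis by (simp add: transfer_det_def partial_bounded_linear axis_def)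
qed

lemma open_set_with_two_families:
  assumes "B \<subseteq> Omega0" "model_field \<in> B"
  shows "\<exists>U. openin (subtopology Omega0_topology B) U \<and> U \<noteq> {} \<and>
    determined_by_jet 3 B U \<and> (\<forall>X\<in>U. has_two_symmetric_periodic_families X)"
proof (intro exI conjI ballI)
  let ?U = "{X \<in> B. 0 < transfer_det X}"
  have "?U = {X. smooth_germ X \<and> 0 < transfer_det X} \<inter> Omega0 \<inter> B"
    using assms(1) smooth_germ_Omega0 by blast
  then show "openin (subtopology Omega0_topology B) ?U"
    using Cinf_open_transfer_det_pos unfolding Omega0_topology_def
    by (auto simp: openin_subtopology openin_Cinf_topology)
  show "?U \<noteq> {}" using assms(2) transfer_det_model_field by force
  show "determined_by_jet 3 B ?U"
    unfolding determined_by_jet_def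
  proof (intro ballI impI)
    fix f g :: "real^4 \<Rightarrow> real^4" assume fg: "f \<in> B" "g \<in> B" and jet: "same_jet 3 f g"
    have "partial i f 0 = partial i g 0" for i
      using jet[unfolded same_jet_def, rule_format, of "[i]"] by simp
    then show "f \<in> ?U \<longleftrightarrow> g \<in> ?U" using fg by (simp add: transfer_det_def)
  qed
  show "has_two_symmetric_periodic_families X" if "X \<in> ?U" for X
    using two_families_of_transfer_det_pos that assms(1) by blast
qed

theorem theoremA:
  shows "(\<exists>U. openin (subtopology Omega0_topology Omega0_B) U \<and> U \<noteq> {} \<and>
              determined_by_jet 3 Omega0_B U \<and>
              (\<forall>X\<in>U. has_two_symmetric_periodic_families X)) \<and>
         (\<exists>U. openin (subtopology Omega0_topology Omega0_omega) U \<and> U \<noteq> {} \<and>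
              determined_by_jet 3 Omega0_omega U \<and>
              (\<forall>X\<in>U. has_two_symmetric_periodic_families X))"
  using open_set_with_two_families[OF _ model_field_Omega0_B]
    open_set_with_two_families[OF _ model_field_Omega0_omega]
  by (auto simp: Omega0_B_def Omega0_omega_def)

end
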